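(* Let $F : \{-1,1\}^n \to \{-1,1\}$ be any symmetric function. \begin{enumerate} \item If $r(F) \ge 5$, then there exists a universal constant $c_1 > 0$ such that $\log\big(wt_{1/3}(F)\big) \ge c_1 \cdot r(F)$. \item If $k = \deg_{oe}(F) \ge 16$, then there exists a universal constant $c_2$ such that $\mathrm{mon}_{\pm}(F) \ge 2^{c_2 \cdot k/\log(n/k)}$. \item If $k = \deg_{oe}(F) \ge 16$, then there exists a universal constant $c_3$ such that $m(F) \le 2^{-c_3 \cdot k/\log(n/k)}$. \end{enumerate}
   Context: A function $F:\{-1,1\}^n\to\{-1,1\}$ is symmetric if its value depends only on the Hamming weight of the input (the number of coordinates equal to $-1$); its predicate is $D_F:\{0,1,\dots,n\}\to\{-1,1\}$, $D_F(i)=F(x)$ for any $x$ with exactly $i$ coordinates equal to $-1$. The odd-even degree is $\deg_{oe}(F)=|\{i\in\{0,1,\dots,n-2\}: D_F(i)\ne D_F(i+2)\}|$. The quantities $r_0=r_0(F)$, $r_1=r_1(F)$ are the minimum integers $r_0', r_1'$ with $r_0',r_1'\le n/2$ such that $D_F(i)=D_F(i+2)$ for all integers $i\in[r_0', n-r_1')$, and $r(F)=\max\{r_0,r_1\}$. Every $p:\{-1,1\}^n\to\mathbb{R}$ has a unique multilinear expansion $p=\sum_{S\subseteq[n]}c_S\prod_{i\in S}x_i$; its weight is $wt(p)=\sum_S|c_S|$. The $\epsilon$-approximate weight $wt_\epsilon(F)$ is the minimum weight of a real polynomial $p$ with $|p(x)-F(x)|<\epsilon$ for all $x\in\{-1,1\}^n$.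 The signed monomial complexity $\mathrm{mon}_\pm(F)$ is the minimum number of monomials of a real polynomial $p$ with $\mathrm{sgn}(p(x))=F(x)$ for all $x$. The margin is $m(F)=\max_{p}\min_{x\in\{-1,1\}^n}p(x)F(x)$, the maximum over real polynomials $p$ with $wt(p)\le 1$ that sign represent $F$ everywhere. Logarithms are base 2.
   Formalization: In parts 2 and 3, log(n/k) is replaced by max(1, log(n/k)) with c_2, c_3 > 0, since for k = n-1 the stated bounds fail for every positive constant; for odd n where no admissible r_0, r_1 ≤ n/2 exist, r(F) is taken as (n+1)/2. *)

theory Defs
  imports Complex_Main "HOL-Library.FuncSet"
begin

definition sign_cube :: "nat \<Rightarrow> (nat \<Rightarrow> real) set" where
  "sign_cube n = {..<n} \<rightarrow>\<^sub>E {-1, 1}"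

definition hamming_weight :: "nat \<Rightarrow> (nat \<Rightarrow> real) \<Rightarrow> nat" where
  "hamming_weight n x = card {i \<in> {..<n}. x i = -1}"

definition symmetric_fun :: "nat \<Rightarrow> ((nat \<Rightarrow> real) \<Rightarrow> real) \<Rightarrow> bool" where
  "symmetric_fun n F \<longleftrightarrow>
     F \<in> sign_cube n \<rightarrow> {-1, 1} \<and>
     (\<forall>x\<in>sign_cube n. \<forall>y\<in>sign_cube n.
        hamming_weight n x = hamming_weight n y \<longrightarrow> F x = F y)"

text \<open>Only meaningful for \<open>i \<le> n\<close>.\<close>

definition predicate_of :: "nat \<Rightarrow> ((nat \<Rightarrow> real) \<Rightarrow> real) \<Rightarrow> nat \<Rightarrow> real" where
  "predicate_of n F i = F (SOME x. x \<in> sign_cube n \<and> hamming_weight n x = i)"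

lemma predicate_of_hamming_weight:
  assumes "symmetric_fun n F" "x \<in> sign_cube n"
  shows "predicate_of n F (hamming_weight n x) = F x"
proof -
  let ?P = "\<lambda>y. y \<in> sign_cube n \<and> hamming_weight n y = hamming_weight n x"
  have "?P (SOME y. ?P y)"
    by (rule someI[of ?P x]) (use assms in simp)
  then show ?thesis
    using assms unfolding predicate_of_def symmetric_fun_def by blast
qed

definition deg_oe :: "nat \<Rightarrow> ((nat \<Rightarrow> real) \<Rightarrow> real) \<Rightarrow> nat" where
  "deg_oe n F = card {i. i + 2 \<le> n \<and> predicate_of n F i \<noteq> predicate_of n F (i + 2)}"

text \<open>\<open>D(i) = D(i+2)\<close> for all \<open>i \<in> [a, n - b)\<close> for which \<open>i + 2\<close> lies in the domain
  \<open>{0..n}\<close> of the predicate \<open>D\<close>. The last proviso matters only for \<open>b = 0\<close>, \<open>i = n - 1\<close>.\<close>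

definition two_periodic_on :: "nat \<Rightarrow> ((nat \<Rightarrow> real) \<Rightarrow> real) \<Rightarrow> nat \<Rightarrow> nat \<Rightarrow> bool" where
  "two_periodic_on n F a b \<longleftrightarrow>
     (\<forall>i. a \<le> i \<and> i + b < n \<and> i + 2 \<le> n \<longrightarrow> predicate_of n F i = predicate_of n F (i + 2))"

text \<open>The pair \<open>(r\<^sub>0, r\<^sub>1)\<close> is the componentwise least pair \<open>(a, b)\<close> with \<open>a, b \<le> n/2\<close> and
  \<open>two_periodic_on n F a b\<close>, whenever such a pair exists (lemma \<open>r_zero_r_one_least\<close>). None exists
  exactly when \<open>n \<ge> 3\<close> is odd and \<open>D((n-1)/2) \<noteq> D((n+3)/2)\<close>, as for majority on an odd number
  of variables; the definitions below then give \<open>r\<^sub>0 = r\<^sub>1 = (n+1)/2\<close>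
  (lemma \<open>r_zero_r_one_odd\<close>).\<close>

definition r_zero :: "nat \<Rightarrow> ((nat \<Rightarrow> real) \<Rightarrow> real) \<Rightarrow> nat" where
  "r_zero n F = (LEAST a. \<exists>b. real b \<le> real n / 2 \<and> two_periodic_on n F a b)"

definition r_one :: "nat \<Rightarrow> ((nat \<Rightarrow> real) \<Rightarrow> real) \<Rightarrow> nat" where
  "r_one n F = (LEAST b. \<exists>a. real a \<le> real n / 2 \<and> two_periodic_on n F a b)"

definition r_max :: "nat \<Rightarrow> ((nat \<Rightarrow> real) \<Rightarrow> real) \<Rightarrow> nat" where
  "r_max n F = max (r_zero n F) (r_one n F)"

lemma r_zero_r_one_least:
  assumes ab: "real a \<le> real n / 2" "real b \<le> real n / 2" "two_periodic_on n F a b"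
  shows "real (r_zero n F) \<le> real n / 2" "real (r_one n F) \<le> real n / 2"
    and "two_periodic_on n F (r_zero n F) (r_one n F)"
    and "r_zero n F \<le> a" "r_one n F \<le> b"
proof -
  let ?P = "\<lambda>a. \<exists>b. real b \<le> real n / 2 \<and> two_periodic_on n F a b"
  let ?Q = "\<lambda>b. \<exists>a. real a \<le> real n / 2 \<and> two_periodic_on n F a b"
  have P: "?P a" and Q: "?Q b" using ab by blast+
  show le: "r_zero n F \<le> a" "r_one n F \<le> b"
    unfolding r_zero_def r_one_def by (rule Least_le, rule P) (rule Least_le, rule Q)
  then show r: "real (r_zero n F) \<le> real n / 2" "real (r_one n F) \<le> real n / 2"
    using ab by linarith+
  have "?P (r_zero n F)" "?Q (r_one n F)"
    unfolding r_zero_def r_one_def by (rule LeastI, rule P) (rule LeastI, rule Q)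
  then obtain a' b' where b': "real b' \<le> real n / 2" "two_periodic_on n F (r_zero n F) b'"
    and a': "real a' \<le> real n / 2" "two_periodic_on n F a' (r_one n F)" by blast
  show "two_periodic_on n F (r_zero n F) (r_one n F)"
    unfolding two_periodic_on_def
  proof (intro allI impI)
    fix i assume i: "r_zero n F \<le> i \<and> i + r_one n F < n \<and> i + 2 \<le> n"
    have "i + b' < n \<or> a' \<le> i" using a'(1) b'(1) by linarith
    then show "predicate_of n F i = predicate_of n F (i + 2)"
      using i a'(2) b'(2) unfolding two_periodic_on_def by blast
  qed
qed

lemma r_zero_r_one_odd:
  assumes n: "n = 2 * m + 1" "n \<ge> 3" and D: "predicate_of n F m \<noteq> predicate_of n F (m + 2)"
  shows "r_zero n F = m + 1" "r_one n F = m + 1"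
    and "\<not> (\<exists>a b. real a \<le> real n / 2 \<and> real b \<le> real n / 2 \<and> two_periodic_on n F a b)"
proof -
  have bad: "m < a \<or> m < b" if "two_periodic_on n F a b" for a b
  proof (rule ccontr)
    assume "\<not> ?thesis"
    then have "a \<le> m" "m + b < n" "m + 2 \<le> n" using n by auto
    then show False using that D unfolding two_periodic_on_def by blast
  qed
  have half: "real k \<le> real n / 2 \<longleftrightarrow> k \<le> m" for k using n by linarith
  have e: "two_periodic_on n F (m + 1) m" "two_periodic_on n F m (m + 1)"
    using n unfolding two_periodic_on_def by auto
  show "r_zero n F = m + 1" "r_one n F = m + 1"
    unfolding r_zero_def r_one_def half
    by (rule Least_equality, use e bad in fastforce, use bad in fastforce)+
  show "\<not> (\<exists>a b. real a \<le> real n / 2 \<and> real b \<le> real n / 2 \<and> two_periodic_on n F a b)"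
    unfolding half using bad by fastforce
qed

text \<open>A multilinear real polynomial in the variables \<open>x i\<close>, \<open>i < n\<close>, is given by its
  coefficients \<open>c S\<close>, \<open>S \<subseteq> {..<n}\<close>; values of \<open>c\<close> elsewhere are ignored.\<close>

definition mpoly_eval :: "nat \<Rightarrow> (nat set \<Rightarrow> real) \<Rightarrow> (nat \<Rightarrow> real) \<Rightarrow> real" where
  "mpoly_eval n c x = (\<Sum>S\<in>Pow {..<n}. c S * (\<Prod>i\<in>S. x i))"

definition mpoly_weight :: "nat \<Rightarrow> (nat set \<Rightarrow> real) \<Rightarrow> real" where
  "mpoly_weight n c = (\<Sum>S\<in>Pow {..<n}. \<bar>c S\<bar>)"

definition num_monomials :: "nat \<Rightarrow> (nat set \<Rightarrow> real) \<Rightarrow> nat" where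
  "num_monomials n c = card {S \<in> Pow {..<n}. c S \<noteq> 0}"

definition sign_represents :: "nat \<Rightarrow> (nat set \<Rightarrow> real) \<Rightarrow> ((nat \<Rightarrow> real) \<Rightarrow> real) \<Rightarrow> bool" where
  "sign_represents n c F \<longleftrightarrow> (\<forall>x\<in>sign_cube n. sgn (mpoly_eval n c x) = F x)"

text \<open>An infimum, since the strict inequality need not allow the minimum to be attained.\<close>

definition approx_weight :: "nat \<Rightarrow> real \<Rightarrow> ((nat \<Rightarrow> real) \<Rightarrow> real) \<Rightarrow> real" where
  "approx_weight n \<epsilon> F =
     Inf {mpoly_weight n c |c. \<forall>x\<in>sign_cube n. \<bar>mpoly_eval n c x - F x\<bar> < \<epsilon>}"

definition signed_monomial_complexity :: "nat \<Rightarrow> ((nat \<Rightarrow> real) \<Rightarrow> real) \<Rightarrow> nat" where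
  "signed_monomial_complexity n F =
     (LEAST m. \<exists>c. sign_represents n c F \<and> num_monomials n c = m)"

definition margin :: "nat \<Rightarrow> ((nat \<Rightarrow> real) \<Rightarrow> real) \<Rightarrow> real" where
  "margin n F =
     Sup {Min ((\<lambda>x. mpoly_eval n c x * F x) ` sign_cube n) |c.
            mpoly_weight n c \<le> 1 \<and> sign_represents n c F}"

text \<open>The denominator \<open>log(n/k)\<close> in the bounds on \<open>signed_monomial_complexity\<close> and \<open>margin\<close>,
  where \<open>k = deg_oe n F < n\<close>. It is truncated below at 1, i.e. changed only for \<open>k > n/2\<close>:
  as \<open>k\<close> approaches \<open>n\<close>, \<open>log(n/k)\<close> tends to 0, and for \<open>k = n - 1\<close> the quotient
  \<open>k/log(n/k)\<close> is of order \<open>n\<^sup>2\<close>, whereas always \<open>signed_monomial_complexity n F \<le> 2^n\<close>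
  and \<open>margin n F \<ge> 2 powr (-n/2)\<close>. Without truncation no positive constant is possible.\<close>

definition log_ratio :: "nat \<Rightarrow> nat \<Rightarrow> real" where
  "log_ratio n k = max 1 (log 2 (real n / real k))"

end

theory Submission
  imports Defs "HOL-Computational_Algebra.Polynomial"
begin

text \<open>Split \<open>4 m\<close> variables into \<open>m\<close> quads of two pairs each. In every quad one pair, chosen at
  random, is set to \<open>(y, y)\<close> and the other one to \<open>(b, -b)\<close>, which has constant Hamming weight, so
  that one may average over \<open>b\<close>. A monomial that contains exactly one variable of some pair of the
  quad becomes 0 for at least one of the two choices, and the other quads contribute only a sign.
  Hence a monomial turns into a monomial of degree \<open>s\<close> in the \<open>y\<close>, where \<open>s\<close> is the number of split
  quads, and survives with probability at most \<open>2\<^sup>-\<^sup>s\<close>. Averaging over all \<open>y\<close> of weight \<open>j\<close>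
  (Minsky--Papert) leaves a univariate polynomial in \<open>j\<close> of degree less than \<open>d\<close> that
  approximates, or equals, the mean of the given polynomial on the Hamming level \<open>m + a + 2 j\<close>, up to
  an error \<open>2\<^sup>-\<^sup>d\<close> times the weight. If the predicate changes its sign \<open>d\<close> times along these levels,
  this bounds the number of monomials and the margin; a pigeonhole argument over dyadic scales
  provides levels with \<open>d\<close> of order \<open>k / log (n/k)\<close>. For the approximate weight the levels are
  centred at a jump of the predicate, where an approximating polynomial needs linear degree.\<close>

section \<open>Restriction to quads\<close>

definition bsign :: "bool \<Rightarrow> real" where
  "bsign t = (if t then -1 else 1)"

text \<open>\<open>r < 4\<close> is the position in the quad, whose pairs are \<open>{0, 1}\<close> and \<open>{2, 3}\<close>; \<open>z\<close> tells whether
  the first pair is the free one.\<close>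

definition quad_val :: "nat \<Rightarrow> bool \<Rightarrow> bool \<Rightarrow> bool \<Rightarrow> real" where
  "quad_val r z b y = (if (r < 2) = z then bsign y else if even r then bsign b else - bsign b)"

text \<open>The sets \<open>z\<close>, \<open>b\<close>, \<open>y\<close> collect the quads in which the respective bit is set. Of the variables
  outside the quads, \<open>a\<close> are set to \<open>-1\<close>, which shifts all Hamming weights.\<close>

definition quad_point :: "nat \<Rightarrow> nat \<Rightarrow> nat \<Rightarrow> nat set \<Rightarrow> nat set \<Rightarrow> nat set \<Rightarrow> nat \<Rightarrow> real" where
  "quad_point n m a z b y = (\<lambda>v\<in>{..<n}.
     if v < m * 4 then quad_val (v mod 4) (v div 4 \<in> z) (v div 4 \<in> b) (v div 4 \<in> y)
     else if v < m * 4 + a then -1 else 1)"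

definition quad_monom :: "nat set \<Rightarrow> nat \<Rightarrow> bool \<Rightarrow> bool \<Rightarrow> bool \<Rightarrow> real" where
  "quad_monom S i z b y = (\<Prod>r<4. if i * 4 + r \<in> S then quad_val r z b y else 1)"

text \<open>The mean over \<open>b\<close> is normalised at \<open>y = False\<close>, where the free
  pair is (1, 1); by \<open>quad_monom_sum\<close> the other value of \<open>y\<close> differs at
  most by a sign.\<close>

definition quad_coeff :: "nat set \<Rightarrow> nat \<Rightarrow> bool \<Rightarrow> real" where
  "quad_coeff S i z = (quad_monom S i z True False + quad_monom S i z False False) / 2"

definition quad_split :: "nat set \<Rightarrow> nat \<Rightarrow> bool" where
  "quad_split S i \<longleftrightarrow> (i * 4 \<in> S) \<noteq> (i * 4 + 1 \<in> S) \<or> (i * 4 + 2 \<in> S) \<noteq> (i * 4 + 3 \<in> S)"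

definition split_quads :: "nat \<Rightarrow> nat set \<Rightarrow> nat set" where
  "split_quads m S = {i \<in> {..<m}. quad_split S i}"

definition tail_sign :: "nat \<Rightarrow> nat \<Rightarrow> nat \<Rightarrow> nat set \<Rightarrow> real" where
  "tail_sign n m a S = (\<Prod>v\<in>{m * 4..<n}. if v \<in> S \<and> v < m * 4 + a then -1 else 1)"

definition restr_coeff :: "nat \<Rightarrow> nat \<Rightarrow> nat \<Rightarrow> nat set \<Rightarrow> nat set \<Rightarrow> real" where
  "restr_coeff n m a z S = tail_sign n m a S * (\<Prod>i<m. quad_coeff S i (i \<in> z))"

definition level :: "nat \<Rightarrow> nat \<Rightarrow> nat set set" where
  "level m j = {y. y \<subseteq> {..<m} \<and> card y = j}"

text \<open>For \<open>T\<close> inside \<open>{..<m}\<close> this is the normalised Krawtchouk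
  value K_j(t) / (m choose j), t = \<open>card T\<close>. By reciprocity it equals K_t(j) / (m
  choose t), hence is a polynomial in \<open>j\<close> of degree at most t.\<close>

definition level_mean :: "nat \<Rightarrow> nat set \<Rightarrow> nat \<Rightarrow> real" where
  "level_mean m T j = (\<Sum>y\<in>level m j. \<Prod>i\<in>T. bsign (i \<in> y)) / real (m choose j)"

text \<open>The set \<open>z\<close> is not averaged: \<open>good_restriction\<close> fixes one
  \<open>z\<close> that serves all levels \<open>j\<close> at once.\<close>

definition block_mean :: "nat \<Rightarrow> nat \<Rightarrow> nat \<Rightarrow> nat set \<Rightarrow> ((nat \<Rightarrow> real) \<Rightarrow> real) \<Rightarrow> nat \<Rightarrow> real" where
  "block_mean n m a z f j =
     (\<Sum>y\<in>level m j. \<Sum>b\<in>Pow {..<m}. f (quad_point n m a z b y)) / (2 ^ m * real (m choose j))"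

lemma finite_level [simp]: "finite (level m j)"
  unfolding level_def by simp

lemma card_level [simp]: "card (level m j) = m choose j"
  unfolding level_def using n_subsets[of "{..<m}" j] by simp

lemma level_subset: "y \<in> level m j \<Longrightarrow> y \<subseteq> {..<m}" "y \<in> level m j \<Longrightarrow> card y = j"
  unfolding level_def by auto

section \<open>Monomials on a single quad\<close>

lemma lessThan_4: "{..<4::nat} = {0, 1, 2, 3}"
  by auto

lemma quad_monom_unfold:
  "quad_monom S i z b y =
     (if i * 4 \<in> S then quad_val 0 z b y else 1) * (if i * 4 + 1 \<in> S then quad_val 1 z b y else 1) *
     (if i * 4 + 2 \<in> S then quad_val 2 z b y else 1) * (if i * 4 + 3 \<in> S then quad_val 3 z b y else 1)"
  unfolding quad_monom_def lessThan_4 by simp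

text \<open>On the pair \<open>(b, -b)\<close>, one variable from \<open>S\<close> averages to 0 and
  two give -1. So if the coefficient is nonzero, only the free pair can be split, and it then
  contributes \<open>bsign y\<close>.\<close>

lemma quad_monom_sum:
  "quad_monom S i z True y + quad_monom S i z False y
     = 2 * quad_coeff S i z * (if quad_split S i then bsign y else 1)"
  unfolding quad_coeff_def quad_monom_unfold quad_split_def
  by (cases z; cases y; cases "i * 4 \<in> S"; cases "i * 4 + 1 \<in> S"; cases "i * 4 + 2 \<in> S";
      cases "i * 4 + 3 \<in> S") (simp_all add: quad_val_def bsign_def)

lemma abs_quad_coeff: "\<bar>quad_coeff S i z\<bar> \<in> {0, 1}"
  unfolding quad_coeff_def quad_monom_unfold
  by (cases z; cases "i * 4 \<in> S"; cases "i * 4 + 1 \<in> S"; cases "i * 4 + 2 \<in> S";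
      cases "i * 4 + 3 \<in> S") (simp_all add: quad_val_def bsign_def)

text \<open>One of the two choices puts \<open>(b, -b)\<close> on a split pair, where the mean over
  \<open>b\<close> vanishes.\<close>

lemma quad_coeff_split:
  assumes "quad_split S i"
  shows "\<bar>quad_coeff S i True\<bar> + \<bar>quad_coeff S i False\<bar> \<le> 1"
  using assms unfolding quad_coeff_def quad_monom_unfold quad_split_def
  by (cases "i * 4 \<in> S"; cases "i * 4 + 1 \<in> S"; cases "i * 4 + 2 \<in> S";
      cases "i * 4 + 3 \<in> S") (simp_all add: quad_val_def bsign_def)

lemma quad_point_in_cube: "quad_point n m a z b y \<in> sign_cube n"
  unfolding quad_point_def sign_cube_def quad_val_def bsign_def by auto

lemma sum_quad:
  fixes f :: "nat \<Rightarrow> nat"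
  shows "(\<Sum>v\<in>{i * 4..<i * 4 + 4}. f v) = (\<Sum>r<4. f (i * 4 + r))"
  using sum.shift_bounds_nat_ivl[of f 0 "i * 4" 4] by (simp add: atLeast0LessThan add.commute)

lemma prod_quad:
  fixes f :: "nat \<Rightarrow> real"
  shows "(\<Prod>v\<in>{i * 4..<i * 4 + 4}. f v) = (\<Prod>r<4. f (i * 4 + r))"
  using prod.shift_bounds_nat_ivl[of f 0 "i * 4" 4] by (simp add: atLeast0LessThan add.commute)

text \<open>Each \<open>(b, -b)\<close> contributes 1, each free pair with \<open>i \<in> y\<close>
  contributes 2, and the variables outside the quads contribute \<open>a\<close>.\<close>

lemma hamming_weight_quad_point:
  assumes "4 * m + a \<le> n" "y \<in> level m j"
  shows "hamming_weight n (quad_point n m a z b y) = m + a + 2 * j"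
proof -
  let ?x = "quad_point n m a z b y"
  let ?e = "\<lambda>v. if ?x v = -1 then 1 else 0::nat"
  have "hamming_weight n ?x = (\<Sum>v<n. ?e v)"
    unfolding hamming_weight_def by (simp add: sum.If_cases Int_def)
  also have "\<dots> = (\<Sum>v<m * 4. ?e v) + (\<Sum>v\<in>{m * 4..<n}. ?e v)"
    using assms(1) by (subst sum.union_disjoint[symmetric]) (auto intro!: sum.cong)
  also have "(\<Sum>v<m * 4. ?e v) = (\<Sum>i<m. 1 + 2 * of_bool (i \<in> y))"
    unfolding sum.nat_group[symmetric] sum_quad
  proof (rule sum.cong)
    fix i assume "i \<in> {..<m}"
    then have i: "i * 4 + r < m * 4" "i * 4 + r < n" if "r < 4" for r using that assms(1) by auto
    have "(\<Sum>r<4. ?e (i * 4 + r))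
        = (\<Sum>r<4. if quad_val r (i \<in> z) (i \<in> b) (i \<in> y) = -1 then 1 else 0)"
      by (intro sum.cong) (simp_all add: quad_point_def i)
    also have "\<dots> = 1 + 2 * of_bool (i \<in> y)"
      unfolding lessThan_4 by (auto simp: quad_val_def bsign_def)
    finally show "(\<Sum>r<4. ?e (i * 4 + r)) = 1 + 2 * of_bool (i \<in> y)" .
  qed simp
  also have "\<dots> = m + 2 * j"
  proof -
    have "{..<m} \<inter> {i. i \<in> y} = y" "card y = j" using level_subset[OF assms(2)] by auto
    then show ?thesis unfolding sum.distrib sum_distrib_left[symmetric] by simp
  qed
  also have "(\<Sum>v\<in>{m * 4..<n}. ?e v) = (\<Sum>v\<in>{m * 4..<n}. if v < m * 4 + a then 1 else 0)"
    by (rule sum.cong) (simp_all add: quad_point_def)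
  also have "\<dots> = card ({m * 4..<n} \<inter> {v. v < m * 4 + a})"
    by (simp add: sum.If_cases)
  also have "{m * 4..<n} \<inter> {v. v < m * 4 + a} = {m * 4..<m * 4 + a}"
    using assms(1) by auto
  finally show ?thesis by simp
qed

section \<open>Block means of functions and of monomials\<close>

lemma block_mean_ge:
  assumes "4 * m + a \<le> n" "j \<le> m"
    and f: "\<And>x. x \<in> sign_cube n \<Longrightarrow> hamming_weight n x = m + a + 2 * j \<Longrightarrow> lo \<le> f x"
  shows "lo \<le> block_mean n m a z f j"
proof -
  have "real (m choose j) * (2 ^ m * lo)
      \<le> (\<Sum>y\<in>level m j. \<Sum>b\<in>Pow {..<m}. f (quad_point n m a z b y))"
  proof (rule order_trans[OF _ sum_bounded_below[of _ "2 ^ m * lo"]])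
    fix y assume "y \<in> level m j"
    then show "2 ^ m * lo \<le> (\<Sum>b\<in>Pow {..<m}. f (quad_point n m a z b y))"
      using sum_bounded_below[of "Pow {..<m}" lo "\<lambda>b. f (quad_point n m a z b y)"]
        f[OF quad_point_in_cube hamming_weight_quad_point[OF assms(1)]]
      by (simp add: card_Pow)
  qed simp
  moreover have "real (m choose j) > 0" using assms(2) by simp
  ultimately show ?thesis
    unfolding block_mean_def by (simp add: pos_le_divide_eq mult_ac)
qed

lemma block_mean_uminus: "block_mean n m a z (\<lambda>x. - f x) j = - block_mean n m a z f j"
  unfolding block_mean_def by (simp add: sum_negf)

lemma block_mean_le:
  assumes "4 * m + a \<le> n" "j \<le> m"
    and "\<And>x. x \<in> sign_cube n \<Longrightarrow> hamming_weight n x = m + a + 2 * j \<Longrightarrow> f x \<le> hi"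
  shows "block_mean n m a z f j \<le> hi"
  using block_mean_ge[OF assms(1,2), of "- hi" "\<lambda>x. - f x" z] assms(3)
  by (simp add: block_mean_uminus)

lemma monomial_quad_point:
  assumes "4 * m \<le> n" "S \<subseteq> {..<n}"
  shows "(\<Prod>v\<in>S. quad_point n m a z b y v)
    = tail_sign n m a S * (\<Prod>i<m. quad_monom S i (i \<in> z) (i \<in> b) (i \<in> y))"
proof -
  let ?x = "quad_point n m a z b y"
  let ?e = "\<lambda>v. if v \<in> S then ?x v else 1"
  have "(\<Prod>v\<in>S. ?x v) = (\<Prod>v<n. ?e v)"
    using assms(2) by (simp add: prod.If_cases Int_absorb1)
  also have "\<dots> = (\<Prod>v<m * 4. ?e v) * (\<Prod>v\<in>{m * 4..<n}. ?e v)"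
    using assms(1) by (subst prod.union_disjoint[symmetric]) (auto intro!: prod.cong)
  also have "(\<Prod>v<m * 4. ?e v) = (\<Prod>i<m. quad_monom S i (i \<in> z) (i \<in> b) (i \<in> y))"
    unfolding prod.nat_group[symmetric] prod_quad quad_monom_def
    using assms(1) by (intro prod.cong) (auto simp: quad_point_def)
  also have "(\<Prod>v\<in>{m * 4..<n}. ?e v) = tail_sign n m a S"
    unfolding tail_sign_def by (intro prod.cong) (auto simp: quad_point_def)
  finally show ?thesis by simp
qed

lemma sum_Pow_prod_bool:
  fixes g :: "'a \<Rightarrow> bool \<Rightarrow> real"
  assumes "finite A"
  shows "(\<Sum>b\<in>Pow A. \<Prod>i\<in>A. g i (i \<in> b)) = (\<Prod>i\<in>A. g i True + g i False)"
proof -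
  have "(\<Prod>i\<in>A. g i (i \<in> b)) = (\<Prod>i\<in>b. g i True) * (\<Prod>i\<in>A - b. g i False)" if "b \<subseteq> A" for b
  proof -
    have "(\<Prod>i\<in>A. g i (i \<in> b)) = (\<Prod>i\<in>b. g i (i \<in> b)) * (\<Prod>i\<in>A - b. g i (i \<in> b))"
      using that assms by (metis mult.commute prod.subset_diff)
    then show ?thesis by simp
  qed
  then show ?thesis
    unfolding prod_add[OF assms] by (intro sum.cong) auto
qed

text \<open>For fixed \<open>y\<close> the sum over \<open>b\<close> factors over the quads; by
  \<open>quad_monom_sum\<close> only the split quads keep a dependence on \<open>y\<close>.\<close>

lemma block_mean_monomial:
  assumes "4 * m \<le> n" "S \<subseteq> {..<n}"
  shows "block_mean n m a z (\<lambda>x. \<Prod>v\<in>S. x v) j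
    = restr_coeff n m a z S * level_mean m (split_quads m S) j"
proof -
  let ?k = "\<Prod>i<m. quad_coeff S i (i \<in> z)"
  have "(\<Sum>b\<in>Pow {..<m}. \<Prod>v\<in>S. quad_point n m a z b y v)
      = 2 ^ m * restr_coeff n m a z S * (\<Prod>i\<in>split_quads m S. bsign (i \<in> y))" for y
  proof -
    have "(\<Sum>b\<in>Pow {..<m}. \<Prod>v\<in>S. quad_point n m a z b y v)
      = tail_sign n m a S * (\<Prod>i<m. quad_monom S i (i \<in> z) True (i \<in> y)
                                     + quad_monom S i (i \<in> z) False (i \<in> y))"
      unfolding monomial_quad_point[OF assms] sum_distrib_left[symmetric]
      by (subst sum_Pow_prod_bool) auto
    also have "\<dots> = tail_sign n m a S * (2 ^ m * ?k *
        (\<Prod>i<m. if quad_split S i then bsign (i \<in> y) else 1))"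
      unfolding quad_monom_sum by (simp add: prod.distrib)
    also have "(\<Prod>i<m. if quad_split S i then bsign (i \<in> y) else 1)
        = (\<Prod>i\<in>split_quads m S. bsign (i \<in> y))"
      by (simp add: prod.If_cases split_quads_def Int_def)
    finally show ?thesis unfolding restr_coeff_def by simp
  qed
  then show ?thesis
    unfolding block_mean_def level_mean_def
    by (simp flip: sum_distrib_left)
qed

lemma block_mean_mpoly:
  assumes "4 * m \<le> n"
  shows "block_mean n m a z (mpoly_eval n c) j
    = (\<Sum>S\<in>Pow {..<n}. c S * restr_coeff n m a z S * level_mean m (split_quads m S) j)"
proof -
  have "block_mean n m a z (mpoly_eval n c) j
    = (\<Sum>S\<in>Pow {..<n}. c S * block_mean n m a z (\<lambda>x. \<Prod>v\<in>S. x v) j)"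
    unfolding block_mean_def mpoly_eval_def sum.swap[of _ "Pow {..<n}" "Pow {..<m}"]
      sum.swap[of _ "Pow {..<n}" "level m j"]
    by (simp only: sum_divide_distrib sum_distrib_left times_divide_eq_right)
  then show ?thesis
    using block_mean_monomial[OF assms] by (simp add: mult.assoc)
qed

section \<open>Survival of monomials under a random choice of \<open>z\<close>\<close>

lemma abs_restr_coeff: "\<bar>restr_coeff n m a z S\<bar> = (\<Prod>i<m. \<bar>quad_coeff S i (i \<in> z)\<bar>)"
proof -
  have "\<bar>tail_sign n m a S\<bar> = 1"
    unfolding tail_sign_def abs_prod by (intro prod.neutral) auto
  then show ?thesis unfolding restr_coeff_def by (simp add: abs_mult abs_prod)
qed

lemma abs_restr_coeff_cases: "\<bar>restr_coeff n m a z S\<bar> \<in> {0, 1}"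
proof -
  have "(\<Prod>i\<in>A. \<bar>quad_coeff S i (i \<in> z)\<bar>) \<in> {0, 1}" if "finite A" for A
    using that
  proof induction
    case (insert i A)
    then show ?case using abs_quad_coeff[of S i "i \<in> z"] by auto
  qed simp
  then show ?thesis unfolding abs_restr_coeff by blast
qed

lemma split_quads_subset: "split_quads m S \<subseteq> {..<m}"
  unfolding split_quads_def by blast

text \<open>The sum over \<open>z\<close> factors over the quads. A split quad has factor at most 1
  and any other at most 2, so the extra power of 2 raises every factor to at most 2.\<close>

lemma sum_abs_restr_coeff:
  "(\<Sum>z\<in>Pow {..<m}. \<bar>restr_coeff n m a z S\<bar>) * 2 ^ card (split_quads m S) \<le> 2 ^ m"
proof -
  have "(\<Sum>z\<in>Pow {..<m}. \<bar>restr_coeff n m a z S\<bar>)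
      = (\<Prod>i<m. \<bar>quad_coeff S i True\<bar> + \<bar>quad_coeff S i False\<bar>)"
    unfolding abs_restr_coeff by (rule sum_Pow_prod_bool) simp
  moreover have "2 ^ card (split_quads m S) = (\<Prod>i<m. if quad_split S i then 2 else 1 :: real)"
    by (simp add: prod.If_cases split_quads_def Int_def)
  ultimately have "(\<Sum>z\<in>Pow {..<m}. \<bar>restr_coeff n m a z S\<bar>) * 2 ^ card (split_quads m S)
      = (\<Prod>i<m. (\<bar>quad_coeff S i True\<bar> + \<bar>quad_coeff S i False\<bar>) * (if quad_split S i then 2 else 1))"
    by (simp only: prod.distrib)
  also have "\<dots> \<le> (\<Prod>i<m. 2)"
  proof (rule prod_mono)
    fix i
    have "\<bar>quad_coeff S i True\<bar> \<le> 1" "\<bar>quad_coeff S i False\<bar> \<le> 1"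
      using abs_quad_coeff[of S i True] abs_quad_coeff[of S i False] by auto
    then show "0 \<le> (\<bar>quad_coeff S i True\<bar> + \<bar>quad_coeff S i False\<bar>) * (if quad_split S i then 2 else 1) \<and>
      (\<bar>quad_coeff S i True\<bar> + \<bar>quad_coeff S i False\<bar>) * (if quad_split S i then 2 else 1) \<le> (2::real)"
      using quad_coeff_split[of S i] by auto
  qed
  finally show ?thesis by simp
qed

text \<open>A monomial with \<open>s\<close> split quads survives for at most a fraction \<open>2\<^sup>-\<^sup>s\<close> of the choices \<open>z\<close>,
  so some \<open>z\<close> is at least as good as the average.\<close>

lemma good_restriction:
  fixes w :: "nat set \<Rightarrow> real"
  assumes "\<And>S. w S \<ge> 0"
  shows "\<exists>z. (\<Sum>S\<in>{S \<in> Pow {..<n}. d \<le> card (split_quads m S)}. w S * \<bar>restr_coeff n m a z S\<bar>)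
      \<le> (\<Sum>S\<in>Pow {..<n}. w S) / 2 ^ d"
proof -
  let ?H = "{S \<in> Pow {..<n}. d \<le> card (split_quads m S)}"
  let ?W = "\<Sum>S\<in>Pow {..<n}. w S"
  let ?f = "\<lambda>z. \<Sum>S\<in>?H. w S * \<bar>restr_coeff n m a z S\<bar>"
  have "(\<Sum>z\<in>Pow {..<m}. ?f z) = (\<Sum>S\<in>?H. w S * (\<Sum>z\<in>Pow {..<m}. \<bar>restr_coeff n m a z S\<bar>))"
    by (subst sum.swap) (simp add: sum_distrib_left)
  also have "\<dots> \<le> (\<Sum>S\<in>?H. w S * (2 ^ m / 2 ^ d))"
  proof (intro sum_mono mult_left_mono assms)
    fix S assume S: "S \<in> ?H"
    have "(\<Sum>z\<in>Pow {..<m}. \<bar>restr_coeff n m a z S\<bar>) * 2 ^ d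
        \<le> (\<Sum>z\<in>Pow {..<m}. \<bar>restr_coeff n m a z S\<bar>) * 2 ^ card (split_quads m S)"
      using S by (intro mult_left_mono power_increasing sum_nonneg) auto
    then have "(\<Sum>z\<in>Pow {..<m}. \<bar>restr_coeff n m a z S\<bar>) * 2 ^ d \<le> 2 ^ m"
      using sum_abs_restr_coeff[of n m a S] by linarith
    then show "(\<Sum>z\<in>Pow {..<m}. \<bar>restr_coeff n m a z S\<bar>) \<le> 2 ^ m / 2 ^ d"
      by (simp add: pos_le_divide_eq)
  qed
  also have "\<dots> = (\<Sum>S\<in>?H. w S) * (2 ^ m / 2 ^ d)"
    by (rule sum_distrib_right[symmetric])
  also have "\<dots> \<le> ?W * (2 ^ m / 2 ^ d)"
    by (intro mult_right_mono sum_mono2) (auto simp: assms)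
  also have "\<dots> = of_nat (card (Pow {..<m})) * (?W / 2 ^ d)"
    by (simp add: card_Pow)
  finally have "(\<Sum>z\<in>Pow {..<m}. ?f z) \<le> of_nat (card (Pow {..<m})) * (?W / 2 ^ d)" .
  moreover have "of_nat (card (Pow {..<m})) * (?W / 2 ^ d) < (\<Sum>z\<in>Pow {..<m}. ?f z)"
    if "\<And>z. ?W / 2 ^ d < ?f z"
    using sum_strict_mono[of "Pow {..<m}" "\<lambda>_. ?W / 2 ^ d" ?f, OF _ Pow_not_empty that] by simp
  ultimately show ?thesis using not_le by meson
qed

section \<open>Minsky--Papert symmetrization\<close>

lemma binomial_polynomial:
  "\<exists>p :: real poly. degree p \<le> u \<and> (\<forall>j::nat. poly p (real j) = real (j choose u))"
proof (intro exI conjI allI)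
  let ?p = "smult (1 / fact u) (\<Prod>i=0..<u. [:- of_nat i, 1:]) :: real poly"
  have "degree (\<Prod>i=0..<u. [:- of_nat i, 1:] :: real poly) \<le> (\<Sum>i=0..<u. 1)"
    by (rule order_trans[OF degree_prod_sum_le]) (auto intro!: sum_mono)
  then show "degree ?p \<le> u" by simp
  show "poly ?p (real j) = real (j choose u)" for j
    by (simp add: binomial_gbinomial gbinomial_prod_rev poly_prod)
qed

text \<open>Removing \<open>U\<close> from \<open>y\<close> leaves a subset of size
  \<open>j - card U\<close> of the remaining points. Divided out, this is the probability that a
  random \<open>y\<close> of size \<open>j\<close> contains \<open>U\<close>.\<close>

lemma card_level_superset:
  assumes "U \<subseteq> {..<m}" "j \<le> m"
  shows "real (card {y \<in> level m j. U \<subseteq> y}) * real (m choose card U)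
    = real (m choose j) * real (j choose card U)"
proof (cases "card U \<le> j")
  case True
  have fU: "finite U" using assms(1) finite_subset by blast
  have "bij_betw (\<lambda>y. y \<union> U) {y. y \<subseteq> {..<m} - U \<and> card y = j - card U} {y \<in> level m j. U \<subseteq> y}"
  proof (rule bij_betwI[where g = "\<lambda>y. y - U"])
    show "(\<lambda>y. y \<union> U) \<in> {y. y \<subseteq> {..<m} - U \<and> card y = j - card U} \<rightarrow> {y \<in> level m j. U \<subseteq> y}"
    proof
      fix y assume y: "y \<in> {y. y \<subseteq> {..<m} - U \<and> card y = j - card U}"
      then have "card (y \<union> U) = card y + card U"
        using fU finite_subset[of y "{..<m}"] by (intro card_Un_disjoint) auto
      then show "y \<union> U \<in> {y \<in> level m j. U \<subseteq> y}"
        using y True assms(1) unfolding level_def by auto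
    qed
    show "(\<lambda>y. y - U) \<in> {y \<in> level m j. U \<subseteq> y} \<rightarrow> {y. y \<subseteq> {..<m} - U \<and> card y = j - card U}"
      using fU by (auto simp: level_def card_Diff_subset)
  qed auto
  then have "card {y \<in> level m j. U \<subseteq> y} = card {y. y \<subseteq> {..<m} - U \<and> card y = j - card U}"
    by (rule bij_betw_same_card[symmetric])
  also have "\<dots> = (m - card U) choose (j - card U)"
    using n_subsets[of "{..<m} - U" "j - card U"] assms(1) fU by (simp add: card_Diff_subset)
  finally show ?thesis
    using choose_mult[OF True assms(2)] by (simp flip: of_nat_mult)
next
  case False
  have "card U \<le> j" if "y \<in> level m j" "U \<subseteq> y" for y
    using level_subset[OF that(1)] that(2) card_mono[of y U] finite_subset by auto
  then have "{y \<in> level m j. U \<subseteq> y} = {}" using False by blast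
  then show ?thesis using False by (simp only: card.empty) simp
qed

text \<open>Write each \<open>bsign (i \<in> y)\<close> as 1 or 1 - 2 and expand the product over
  subsets \<open>U\<close> of \<open>T\<close>. In the result \<open>j\<close> enters only through
  \<open>j choose card U\<close>, a polynomial in \<open>j\<close>.\<close>

lemma level_mean_expand:
  assumes "T \<subseteq> {..<m}" "j \<le> m"
  shows "level_mean m T j
    = (\<Sum>U\<in>Pow T. (-2) ^ card U / real (m choose card U) * real (j choose card U))"
proof -
  have fT: "finite T" using assms(1) finite_subset by blast
  have sub: "card U \<le> m" "finite U" "U \<subseteq> {..<m}" if "U \<subseteq> T" for U
    using that assms(1) fT card_mono[of "{..<m}" U] finite_subset[of U T] by auto
  have "(\<Prod>i\<in>T. bsign (i \<in> y)) = (\<Sum>U\<in>Pow T. (-2) ^ card U * of_bool (U \<subseteq> y))" for y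
  proof -
    have "(\<Prod>i\<in>T. bsign (i \<in> y)) = (\<Prod>i\<in>T. (if i \<in> y then -2 else 0) + 1)"
      by (intro prod.cong) (auto simp: bsign_def)
    also have "\<dots> = (\<Sum>U\<in>Pow T. \<Prod>i\<in>U. if i \<in> y then -2 else 0)"
      unfolding prod_add[OF fT] by simp
    also have "\<dots> = (\<Sum>U\<in>Pow T. (-2) ^ card U * of_bool (U \<subseteq> y))"
    proof (rule sum.cong)
      fix U assume "U \<in> Pow T"
      then have fU: "finite U" using sub by auto
      show "(\<Prod>i\<in>U. if i \<in> y then -2 else 0) = (-2 :: real) ^ card U * of_bool (U \<subseteq> y)"
      proof (cases "U \<subseteq> y")
        case True
        then have "(\<Prod>i\<in>U. if i \<in> y then -2 else 0) = (\<Prod>i\<in>U. -2 :: real)"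
          by (intro prod.cong) auto
        then show ?thesis using True by simp
      next
        case False
        then show ?thesis using fU by (auto intro!: prod_zero)
      qed
    qed simp
    finally show ?thesis .
  qed
  then have "level_mean m T j
      = (\<Sum>U\<in>Pow T. (-2) ^ card U * real (card {y \<in> level m j. U \<subseteq> y})) / real (m choose j)"
    unfolding level_mean_def
    by (simp add: sum.swap[of _ _ "level m j"] Int_def flip: sum_distrib_left)
  also have "\<dots> = (\<Sum>U\<in>Pow T. (-2) ^ card U / real (m choose card U) * real (j choose card U))"
    unfolding sum_divide_distrib
  proof (rule sum.cong)
    fix U assume "U \<in> Pow T"
    then have U: "U \<subseteq> {..<m}" "real (m choose card U) > 0" using sub by (auto simp: zero_less_binomial)
    have mj: "real (m choose j) > 0" using assms(2) by simp
    have "real (card {y \<in> level m j. U \<subseteq> y}) / real (m choose j)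
        = real (j choose card U) / real (m choose card U)"
      using card_level_superset[OF U(1) assms(2)] U(2) mj by (simp add: field_simps)
    then show "(-2) ^ card U * real (card {y \<in> level m j. U \<subseteq> y}) / real (m choose j)
      = (-2) ^ card U / real (m choose card U) * real (j choose card U)"
      by (metis (no_types, lifting) times_divide_eq_left times_divide_eq_right)
  qed simp
  finally show ?thesis .
qed

lemma level_mean_polynomial:
  assumes "T \<subseteq> {..<m}"
  shows "\<exists>p :: real poly. degree p \<le> card T \<and> (\<forall>j\<le>m. poly p (real j) = level_mean m T j)"
proof -
  obtain q :: "nat \<Rightarrow> real poly"
    where q: "\<And>u. degree (q u) \<le> u" "\<And>u j::nat. poly (q u) (real j) = real (j choose u)"
    using binomial_polynomial by metis
  have fT: "finite T" using assms finite_subset by blast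
  let ?p = "\<Sum>U\<in>Pow T. smult ((-2) ^ card U / real (m choose card U)) (q (card U))"
  show ?thesis
  proof (intro exI conjI allI impI)
    show "degree ?p \<le> card T"
    proof (rule degree_sum_le)
      fix U assume "U \<in> Pow T"
      then have "card U \<le> card T" using fT by (simp add: card_mono)
      then show "degree (smult ((-2) ^ card U / real (m choose card U)) (q (card U))) \<le> card T"
        by (intro order_trans[OF degree_smult_le] order_trans[OF q(1)])
    qed (use fT in simp)
    show "poly ?p (real j) = level_mean m T j" if "j \<le> m" for j
      unfolding level_mean_expand[OF assms that] by (simp add: poly_sum q(2))
  qed
qed

lemma abs_level_mean_le: "\<bar>level_mean m T j\<bar> \<le> 1"
proof -
  have "\<bar>\<Sum>y\<in>level m j. \<Prod>i\<in>T. bsign (i \<in> y)\<bar> \<le> (\<Sum>y\<in>level m j. \<bar>\<Prod>i\<in>T. bsign (i \<in> y)\<bar>)"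
    by (rule sum_abs)
  also have "\<dots> = (\<Sum>y\<in>level m j. 1)"
    by (intro sum.cong) (auto simp: abs_prod bsign_def intro!: prod.neutral)
  finally show ?thesis
    unfolding level_mean_def by (simp add: abs_divide divide_le_eq)
qed

text \<open>Monomials with fewer than \<open>d\<close> split quads give the polynomial
  \<open>g\<close>. The others are bounded by their surviving weight, as level means have absolute
  value at most 1.\<close>

lemma block_mean_approx:
  assumes "4 * m \<le> n" "d \<ge> 1"
  shows "\<exists>g :: real poly. degree g < d \<and>
    (\<forall>j\<le>m. \<bar>block_mean n m a z (mpoly_eval n c) j - poly g (real j)\<bar>
      \<le> (\<Sum>S\<in>{S \<in> Pow {..<n}. d \<le> card (split_quads m S)}. \<bar>c S\<bar> * \<bar>restr_coeff n m a z S\<bar>))"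
proof -
  obtain q where q: "\<And>S. degree (q S) \<le> card (split_quads m S)"
    "\<And>S j. j \<le> m \<Longrightarrow> poly (q S) (real j) = level_mean m (split_quads m S) j"
    using level_mean_polynomial[OF split_quads_subset] by metis
  let ?H = "{S \<in> Pow {..<n}. d \<le> card (split_quads m S)}"
  let ?L = "{S \<in> Pow {..<n}. \<not> d \<le> card (split_quads m S)}"
  let ?g = "\<Sum>S\<in>?L. smult (c S * restr_coeff n m a z S) (q S)"
  show ?thesis
  proof (intro exI conjI allI impI)
    have "degree ?g \<le> d - 1"
    proof (rule degree_sum_le)
      fix S assume "S \<in> ?L"
      then have "card (split_quads m S) \<le> d - 1" by auto
      then show "degree (smult (c S * restr_coeff n m a z S) (q S)) \<le> d - 1"
        by (intro order_trans[OF degree_smult_le] order_trans[OF q(1)])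
    qed simp
    then show "degree ?g < d" using assms(2) by linarith
    fix j assume j: "j \<le> m"
    let ?t = "\<lambda>S. c S * restr_coeff n m a z S * level_mean m (split_quads m S) j"
    have "block_mean n m a z (mpoly_eval n c) j = sum ?t ?H + sum ?t ?L"
      unfolding block_mean_mpoly[OF assms(1)]
      by (subst sum.union_disjoint[symmetric]) (auto intro!: sum.cong)
    moreover have "poly ?g (real j) = sum ?t ?L"
      by (simp add: poly_sum q(2)[OF j])
    moreover have "\<bar>sum ?t ?H\<bar> \<le> (\<Sum>S\<in>?H. \<bar>c S\<bar> * \<bar>restr_coeff n m a z S\<bar>)"
    proof (rule order_trans[OF sum_abs sum_mono])
      fix S
      show "\<bar>?t S\<bar> \<le> \<bar>c S\<bar> * \<bar>restr_coeff n m a z S\<bar>"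
        using abs_level_mean_le[of m "split_quads m S" j]
        by (simp add: abs_mult mult_left_le)
    qed
    ultimately show "\<bar>block_mean n m a z (mpoly_eval n c) j - poly ?g (real j)\<bar>
      \<le> (\<Sum>S\<in>?H. \<bar>c S\<bar> * \<bar>restr_coeff n m a z S\<bar>)" by simp
  qed
qed

lemma block_mean_approx_weight:
  assumes "4 * m \<le> n" "d \<ge> 1"
  shows "\<exists>(g :: real poly) z. degree g < d \<and>
    (\<forall>j\<le>m. \<bar>block_mean n m a z (mpoly_eval n c) j - poly g (real j)\<bar> \<le> mpoly_weight n c / 2 ^ d)"
proof -
  obtain z where z: "(\<Sum>S\<in>{S \<in> Pow {..<n}. d \<le> card (split_quads m S)}.
      \<bar>c S\<bar> * \<bar>restr_coeff n m a z S\<bar>) \<le> mpoly_weight n c / 2 ^ d"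
    unfolding mpoly_weight_def
    using good_restriction[where w = "\<lambda>S. \<bar>c S\<bar>" and n = n and d = d and m = m and a = a, OF abs_ge_zero]
    by blast
  obtain g :: "real poly" where "degree g < d"
    and g: "\<forall>j\<le>m. \<bar>block_mean n m a z (mpoly_eval n c) j - poly g (real j)\<bar>
      \<le> (\<Sum>S\<in>{S \<in> Pow {..<n}. d \<le> card (split_quads m S)}. \<bar>c S\<bar> * \<bar>restr_coeff n m a z S\<bar>)"
    using block_mean_approx[OF assms] by blast
  moreover have "\<forall>j\<le>m. \<bar>block_mean n m a z (mpoly_eval n c) j - poly g (real j)\<bar> \<le> mpoly_weight n c / 2 ^ d"
    using g order_trans[OF _ z] by blast
  ultimately show ?thesis by blast
qed

text \<open>With the indicator of nonzero coefficients as weight, \<open>good_restriction\<close>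
  counts monomials. For some \<open>z\<close> fewer than 1 of those with at least \<open>d\<close>
  split quads survive; the count is an integer, so none does.\<close>

lemma block_mean_eq_polynomial:
  assumes "4 * m \<le> n" "d \<ge> 1" "num_monomials n c < 2 ^ d"
  shows "\<exists>(g :: real poly) z. degree g < d \<and>
    (\<forall>j\<le>m. block_mean n m a z (mpoly_eval n c) j = poly g (real j))"
proof -
  let ?H = "{S \<in> Pow {..<n}. d \<le> card (split_quads m S)}"
  let ?w = "\<lambda>S. of_bool (c S \<noteq> 0) :: real"
  have w0: "?w S \<ge> 0" for S by simp
  obtain z where "(\<Sum>S\<in>?H. ?w S * \<bar>restr_coeff n m a z S\<bar>) \<le> (\<Sum>S\<in>Pow {..<n}. ?w S) / 2 ^ d"
    using good_restriction[where w = ?w and n = n and d = d and m = m and a = a] w0 by meson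
  also have "(\<Sum>S\<in>Pow {..<n}. ?w S) = real (num_monomials n c)"
    unfolding num_monomials_def by (simp add: Int_def)
  also have "real (num_monomials n c) / 2 ^ d < 1"
    using iffD2[OF of_nat_less_iff[where 'a = real] assms(3)] by simp
  finally have z: "(\<Sum>S\<in>?H. ?w S * \<bar>restr_coeff n m a z S\<bar>) < 1" .
  have "\<bar>c S\<bar> * \<bar>restr_coeff n m a z S\<bar> = 0" if "S \<in> ?H" for S
  proof -
    have "?w S * \<bar>restr_coeff n m a z S\<bar> \<le> (\<Sum>S\<in>?H. ?w S * \<bar>restr_coeff n m a z S\<bar>)"
      using that by (intro member_le_sum) auto
    then have "?w S * \<bar>restr_coeff n m a z S\<bar> < 1" using z by linarith
    then show ?thesis using abs_restr_coeff_cases[of n m a z S] by (cases "c S = 0") auto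
  qed
  then have H0: "(\<Sum>S\<in>?H. \<bar>c S\<bar> * \<bar>restr_coeff n m a z S\<bar>) = 0"
    by (intro sum.neutral) blast
  obtain g :: "real poly" where "degree g < d"
    and "\<forall>j\<le>m. \<bar>block_mean n m a z (mpoly_eval n c) j - poly g (real j)\<bar> \<le> 0"
    using block_mean_approx[OF assms(1,2), of a z c] unfolding H0 by blast
  then show ?thesis by fastforce
qed

section \<open>Univariate polynomials\<close>

text \<open>Each sign change forces a root strictly between \<open>j\<close> and
  \<open>Suc j\<close>, and these intervals are disjoint.\<close>

lemma sign_changes_le_degree:
  fixes g :: "real poly" and D :: "nat \<Rightarrow> real"
  assumes g: "\<And>j. j \<le> m \<Longrightarrow> 0 < poly g (real j) * D j"
    and D: "\<And>j. j \<le> m \<Longrightarrow> D j \<in> {-1, 1}"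
  shows "card {j. j < m \<and> D j \<noteq> D (Suc j)} \<le> degree g"
proof -
  let ?J = "{j. j < m \<and> D j \<noteq> D (Suc j)}"
  have "\<exists>x. real j < x \<and> x < real (Suc j) \<and> poly g x = 0" if "j \<in> ?J" for j
  proof -
    have "poly g (real j) * poly g (real (Suc j)) < 0"
      using that g[of j] g[of "Suc j"] D[of j] D[of "Suc j"]
      by (auto simp: mult_less_0_iff zero_less_mult_iff)
    then show ?thesis using poly_IVT[of "real j" "real (Suc j)" g] by auto
  qed
  then obtain r where r: "\<And>j. j \<in> ?J \<Longrightarrow> real j < r j \<and> r j < real (Suc j) \<and> poly g (r j) = 0"
    by metis
  have "inj_on r ?J"
  proof (rule inj_onI)
    fix i j assume "i \<in> ?J" "j \<in> ?J" "r i = r j"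
    then have "real i < real (Suc j)" "real j < real (Suc i)" using r[of i] r[of j] by auto
    then show "i = j" by linarith
  qed
  have "g \<noteq> 0" using g[of 0] by auto
  have "card ?J = card (r ` ?J)" using \<open>inj_on r ?J\<close> by (simp add: card_image)
  also have "\<dots> \<le> card {x. poly g x = 0}"
    using r by (intro card_mono poly_roots_finite \<open>g \<noteq> 0\<close>) auto
  also have "\<dots> \<le> degree g" by (rule card_poly_roots_bound[OF \<open>g \<noteq> 0\<close>])
  finally show ?thesis .
qed

section \<open>Finite differences and low-degree jumps\<close>

lemma alternating_binomial_sum_Suc:
  fixes f :: "nat \<Rightarrow> real"
  shows "(\<Sum>i\<le>Suc n. (-1) ^ i * real (Suc n choose i) * f i)
    = (\<Sum>i\<le>n. (-1) ^ i * real (n choose i) * (f i - f (Suc i)))"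
proof -
  have "(\<Sum>i\<le>n. (-1) ^ i * real (n choose i) * f i) = (\<Sum>i\<le>Suc n. (-1) ^ i * real (n choose i) * f i)"
    by simp
  also have "\<dots> = f 0 + (\<Sum>i\<le>n. (-1) ^ Suc i * real (n choose Suc i) * f (Suc i))"
    by (simp only: sum.atMost_Suc_shift) simp
  finally have "(\<Sum>i\<le>n. (-1) ^ i * real (n choose i) * (f i - f (Suc i)))
      = f 0 + (\<Sum>i\<le>n. (-1) ^ Suc i * real (Suc n choose Suc i) * f (Suc i))"
    by (simp add: algebra_simps sum.distrib sum_subtractf sum_negf)
  then show ?thesis by (simp only: sum.atMost_Suc_shift) simp
qed

text \<open>Up to sign this is the \<open>n\<close>-th finite difference of \<open>p\<close> at 0,
  and each difference lowers the degree. The alternative \<open>p = 0\<close> is needed because the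
  zero polynomial has degree 0, which is not below \<open>n = 0\<close>.\<close>

lemma alternating_binomial_sum_poly:
  fixes p :: "real poly"
  assumes "p = 0 \<or> degree p < n"
  shows "(\<Sum>i\<le>n. (-1) ^ i * real (n choose i) * poly p (real i)) = 0"
  using assms
proof (induction n arbitrary: p)
  case (Suc n)
  let ?s = "pcompose p [:1, 1:]"
  have d: "degree ?s = degree p" by (simp add: degree_pcompose)
  have "coeff ?s (degree p) = coeff p (degree p)"
    using lead_coeff_comp[of "[:1, 1:] :: real poly" p] unfolding d by simp
  then have "p - ?s = 0 \<or> degree (p - ?s) < degree p"
    using degree_diff_le[of p "degree p" ?s] d by (intro eq_zero_or_degree_less) auto
  then have "p - ?s = 0 \<or> degree (p - ?s) < n" using Suc.prems by auto
  from Suc.IH[OF this] show ?case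
    unfolding alternating_binomial_sum_Suc by (simp add: poly_pcompose add.commute)
qed auto

lemma sum_inverse_squares_le: "(\<Sum>k=1..n. 1 / (real k)\<^sup>2) \<le> 2"
proof -
  \<comment> \<open>The subtracted term makes the induction work: 1/(k+1)^2 \<le> 1/k - 1/(k+1)
    telescopes.\<close>
  have "(\<Sum>k=1..Suc n. 1 / (real k)\<^sup>2) \<le> 2 - 1 / real (Suc n)" for n
  proof (induction n)
    case (Suc n)
    have "1 / (real (Suc (Suc n)))\<^sup>2 \<le> 1 / real (Suc n) - 1 / real (Suc (Suc n))"
    proof -
      let ?x = "real (Suc n)"
      have "1 / (?x + 1)\<^sup>2 \<le> 1 / (?x * (?x + 1))"
        by (intro divide_left_mono) (auto simp: power2_eq_square)
      also have "\<dots> = 1 / ?x - 1 / (?x + 1)" by (simp add: field_simps)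
      finally show ?thesis by (simp add: add.commute)
    qed
    with Suc show ?case by simp
  qed simp
  from this[of "n - 1"] show ?thesis
    by (cases n) (auto intro: order_trans)
qed

lemma sum_inverse_squares_centered_le:
  "(\<Sum>i\<in>{..2 * n} - {n}. 1 / (real i - real n)\<^sup>2) \<le> 4"
proof -
  let ?f = "\<lambda>i. 1 / (real i - real n)\<^sup>2"
  have "{..2 * n} - {n} = {..<n} \<union> {n<..2 * n}" by auto
  then have "sum ?f ({..2 * n} - {n}) = sum ?f {..<n} + sum ?f {n<..2 * n}"
    using sum.union_disjoint[of "{..<n}" "{n<..2 * n}" ?f] by (simp add: disjoint_iff)
  also have "sum ?f {..<n} = (\<Sum>k=1..n. 1 / (real k)\<^sup>2)"
    by (rule sum.reindex_bij_witness[of _ "\<lambda>k. n - k" "\<lambda>i. n - i"])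
      (auto simp: of_nat_diff power2_commute)
  also have "sum ?f {n<..2 * n} = (\<Sum>k=1..n. 1 / (real k)\<^sup>2)"
    by (rule sum.reindex_bij_witness[of _ "\<lambda>k. n + k" "\<lambda>i. i - n"]) (auto simp: of_nat_diff)
  finally show ?thesis using sum_inverse_squares_le[of n] by simp
qed

text \<open>For the even part \<open>G\<close> of \<open>p\<close>, the polynomial \<open>Q = (G - G(1)) / (x\<^sup>2 - 1)\<close> has degree less
  than \<open>2 L\<close>, so its alternating binomial sum over the grid \<open>10 l\<close>, \<open>\<bar>l\<bar> \<le> L\<close>, vanishes. This
  expresses \<open>G(0) - G(1)\<close> by values of \<open>G\<close> with weights that decay like \<open>1 / (10 l)\<^sup>2\<close>.\<close>

lemma no_low_degree_jump_at_0:
  fixes p :: "real poly"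
  assumes L: "L \<ge> 1" and deg: "degree p < 2 * L + 2"
    and p0: "poly p 0 \<ge> 7 / 12" and p1: "poly p 1 \<le> -7 / 12"
    and bnd: "\<And>x. \<bar>x\<bar> = 1 \<or> (\<exists>l. 1 \<le> l \<and> l \<le> L \<and> \<bar>x\<bar> = 10 * real l) \<Longrightarrow> \<bar>poly p x\<bar> \<le> 17 / 12"
  shows False
proof -
  define G where "G = smult (1 / 2) (p + pcompose p [:0, -1:])"
  have G: "poly G x = poly p x / 2 + poly p (- x) / 2" for x
    unfolding G_def by (simp add: poly_pcompose add_divide_distrib)
  have degG: "degree G \<le> degree p"
    unfolding G_def by (rule order_trans[OF degree_smult_le]) (simp add: degree_add_le degree_pcompose)
  let ?c = "poly G 1"
  \<comment> \<open>5/12 is the mean of -7/12, the bound at 1, and 17/12, the bound at -1.\<close>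
  have c: "\<bar>?c\<bar> \<le> 17 / 12" "?c \<le> 5 / 12"
  proof -
    have "\<bar>poly p 1\<bar> \<le> 17 / 12" "\<bar>poly p (-1)\<bar> \<le> 17 / 12" by (rule bnd; simp)+
    then have "poly p 1 \<le> 17 / 12" "- 17 / 12 \<le> poly p 1" "poly p (-1) \<le> 17 / 12" "- 17 / 12 \<le> poly p (-1)"
      unfolding abs_le_iff by linarith+
    note b = this
    have "?c \<le> 17 / 12" "- ?c \<le> 17 / 12" using b unfolding G by linarith+
    then show "\<bar>?c\<bar> \<le> 17 / 12" by (rule abs_leI)
    show "?c \<le> 5 / 12" using b p1 unfolding G by linarith
  qed
  have "poly (G - [:?c:]) 1 = 0" by simp
  then obtain R where R: "G - [:?c:] = [:-1, 1:] * R"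
    unfolding poly_eq_0_iff_dvd by blast
  \<comment> \<open>Evenness of \<open>G\<close> turns the root 1 into the further root -1.\<close>
  have "poly (G - [:?c:]) (-1) = 0" unfolding poly_diff G by simp
  then have "poly R (-1) = 0" unfolding R by simp
  then obtain Q where "R = [:1, 1:] * Q"
    unfolding poly_eq_0_iff_dvd by auto
  then have GQ: "G - [:?c:] = [:-1, 0, 1:] * Q" using R by (simp add: mult.assoc[symmetric])
  have Qx: "poly Q x = (poly G x - ?c) / (x\<^sup>2 - 1)" if "x\<^sup>2 \<noteq> 1" for x
    using arg_cong[OF GQ, of "\<lambda>q. poly q x"] that
    by (simp add: field_simps power2_eq_square)
  have "Q = 0 \<or> degree Q < 2 * L"
  proof (cases "Q = 0")
    case False
    then have "degree (G - [:?c:]) = 2 + degree Q"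
      unfolding GQ by (subst degree_mult_eq) auto
    moreover have "degree (G - [:?c:]) \<le> degree p"
      using degG by (intro degree_diff_le) auto
    ultimately show ?thesis using deg by linarith
  qed simp
  \<comment> \<open>The grid points become 0, ..., \<open>2 * L\<close>, with the origin at index
    \<open>L\<close>.\<close>
  define Q' where "Q' = pcompose Q [:- 10 * real L, 10:]"
  have Q': "poly Q' (real i) = poly Q (10 * (real i - real L))" for i
    unfolding Q'_def by (simp add: poly_pcompose algebra_simps)
  have "Q' = 0 \<or> degree Q' < 2 * L"
    using \<open>Q = 0 \<or> degree Q < 2 * L\<close> unfolding Q'_def by (auto simp: degree_pcompose)
  from alternating_binomial_sum_poly[OF this]
  have "(-1) ^ L * real (2 * L choose L) * poly Q' (real L)
      = - (\<Sum>i\<in>{..2 * L} - {L}. (-1) ^ i * real (2 * L choose i) * poly Q' (real i))"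
    by (subst (asm) sum.remove[of _ L]) (simp, simp, rule eq_neg_iff_add_eq_0[THEN iffD2])
  then have "\<bar>(-1) ^ L * real (2 * L choose L) * poly Q' (real L)\<bar>
      = \<bar>\<Sum>i\<in>{..2 * L} - {L}. (-1) ^ i * real (2 * L choose i) * poly Q' (real i)\<bar>"
    by simp
  \<comment> \<open>At a grid point x = 10 l with l nonzero, G(x) - G(1) is at most 17/6 in absolute
    value and x^2 - 1 is at least 99 l^2; 17/594 is (17/6)/99.\<close>
  also have "\<dots> \<le> (\<Sum>i\<in>{..2 * L} - {L}.
      real (2 * L choose L) * (17 / 594) * (1 / (real i - real L)\<^sup>2))"
  proof (rule order_trans[OF sum_abs sum_mono])
    fix i assume i: "i \<in> {..2 * L} - {L}"
    let ?x = "10 * (real i - real L)"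
    have "1 \<le> \<bar>real i - real L\<bar>" using i by (cases "i < L") auto
    from one_le_power[OF this, of 2] have d1: "1 \<le> (real i - real L)\<^sup>2" by (simp only: power2_abs)
    have x2: "?x\<^sup>2 = 100 * (real i - real L)\<^sup>2" unfolding power_mult_distrib by simp
    define l where "l = (if i < L then L - i else i - L)"
    have l: "1 \<le> l" "l \<le> L" "\<bar>?x\<bar> = 10 * real l"
      using i unfolding l_def by (auto simp: of_nat_diff)
    then have "\<bar>poly p ?x\<bar> \<le> 17 / 12" "\<bar>poly p (- ?x)\<bar> \<le> 17 / 12"
      by (intro bnd disjI2 exI[of _ l]; simp)+
    then have "poly G ?x \<le> 17 / 12" "- poly G ?x \<le> 17 / 12" unfolding G abs_le_iff by linarith+
    then have "\<bar>poly G ?x\<bar> \<le> 17 / 12" by (rule abs_leI)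
    then have "\<bar>poly G ?x - ?c\<bar> \<le> 17 / 6" using c(1) by linarith
    moreover have x1: "99 * (real i - real L)\<^sup>2 \<le> ?x\<^sup>2 - 1" using d1 x2 by linarith
    moreover have "\<bar>poly Q ?x\<bar> = \<bar>poly G ?x - ?c\<bar> / (?x\<^sup>2 - 1)"
    proof -
      have "?x\<^sup>2 \<noteq> 1" and x0: "0 < ?x\<^sup>2 - 1" using d1 x1 by linarith+
      from Qx[OF this(1)] show ?thesis by (simp only: abs_divide abs_of_pos[OF x0])
    qed
    ultimately have "\<bar>poly Q ?x\<bar> \<le> (17 / 6) / (99 * (real i - real L)\<^sup>2)"
      using i by (simp only:) (rule frac_le; simp)
    then have "\<bar>poly Q' (real i)\<bar> \<le> (17 / 594) * (1 / (real i - real L)\<^sup>2)"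
      unfolding Q' by simp
    moreover have "real (2 * L choose i) \<le> real (2 * L choose L)"
      using binomial_maximum'[of L i] by simp
    ultimately have "real (2 * L choose i) * \<bar>poly Q' (real i)\<bar>
        \<le> real (2 * L choose L) * ((17 / 594) * (1 / (real i - real L)\<^sup>2))"
      by (intro mult_mono) auto
    then show "\<bar>(-1) ^ i * real (2 * L choose i) * poly Q' (real i)\<bar>
        \<le> real (2 * L choose L) * (17 / 594) * (1 / (real i - real L)\<^sup>2)"
      by (simp add: abs_mult power_abs mult.assoc)
  qed
  also have "\<dots> = real (2 * L choose L) * (17 / 594) * (\<Sum>i\<in>{..2 * L} - {L}. 1 / (real i - real L)\<^sup>2)"
    by (rule sum_distrib_left[symmetric])
  also have "\<dots> \<le> real (2 * L choose L) * (17 / 594) * 4"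
    by (intro mult_left_mono sum_inverse_squares_centered_le) auto
  finally have "real (2 * L choose L) * \<bar>poly Q' (real L)\<bar> \<le> real (2 * L choose L) * (34 / 297)"
    by (simp add: abs_mult power_abs)
  moreover have "0 < real (2 * L choose L)" by simp
  ultimately have "\<bar>poly Q' (real L)\<bar> \<le> 34 / 297"
    by (simp only: mult_le_cancel_left_pos)
  \<comment> \<open>At 0 the divisor x^2 - 1 is -1. The difference is at most 5/12 - 7/12 = -1/6,
    while its absolute value is at most 34/297 < 1/6.\<close>
  moreover have "poly Q' (real L) = ?c - poly p 0"
    unfolding Q' using Qx[of 0] by (simp add: G[of 0])
  ultimately show False using c(2) p0 by linarith
qed

text \<open>Translation by \<open>h\<close> and multiplication by \<open>D h\<close> reduce a jump
  to one from 1 to -1 between 0 and 1. The error 5/12 yields the constants 7/12 and 17/12, and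
  \<open>10 * L \<le> h\<close> keeps the grid inside the range of \<open>D\<close>.\<close>

lemma no_low_degree_jump:
  fixes g :: "real poly" and D :: "nat \<Rightarrow> real"
  assumes L: "L \<ge> 1" "10 * L \<le> h" and deg: "degree g < 2 * L + 2"
    and g: "\<And>j. j \<le> 2 * h + 1 \<Longrightarrow> \<bar>poly g (real j) - D j\<bar> \<le> 5 / 12"
    and D: "\<And>j. j \<le> 2 * h + 1 \<Longrightarrow> D j \<in> {-1, 1}"
  shows "D h = D (Suc h)"
proof (rule ccontr)
  assume ne: "D h \<noteq> D (Suc h)"
  define p where "p = smult (D h) (pcompose g [:real h, 1:])"
  have p: "poly p x = D h * poly g (real h + x)" for x
    unfolding p_def by (simp add: poly_pcompose)
  have Dh: "D h \<in> {-1, 1}" "D (Suc h) = - D h" using D[of h] D[of "Suc h"] ne by auto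
  have gb: "\<bar>poly g (real j)\<bar> \<le> 17 / 12" if "j \<le> 2 * h + 1" for j
    using g[OF that] D[OF that] unfolding abs_le_iff by (elim insertE) simp_all
  have pb: "\<bar>poly p x\<bar> \<le> 17 / 12" if "\<bar>x\<bar> = real k" "k \<le> h" for x k
  proof -
    have "real h + x = real (h + k) \<or> real h + x = real (h - k)"
      using that by (auto simp: of_nat_diff abs_if split: if_splits)
    then have "\<bar>poly g (real h + x)\<bar> \<le> 17 / 12"
      using gb[of "h + k"] gb[of "h - k"] that(2) by auto
    then show ?thesis unfolding p using Dh(1) by (auto simp: abs_mult)
  qed
  show False
  proof (rule no_low_degree_jump_at_0[OF L(1), of p])
    show "degree p < 2 * L + 2"
      unfolding p_def using deg by (intro le_less_trans[OF degree_smult_le]) (simp add: degree_pcompose)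
    have gh: "\<bar>poly g (real h) - D h\<bar> \<le> 5 / 12" "\<bar>poly g (1 + real h) - D (Suc h)\<bar> \<le> 5 / 12"
      using g[of h] g[of "Suc h"] by simp_all
    show "poly p 0 \<ge> 7 / 12"
      using gh(1) Dh(1) unfolding p abs_le_iff by (elim insertE) simp_all
    show "poly p 1 \<le> -7 / 12"
      using gh(2) Dh unfolding p abs_le_iff by (elim insertE) (simp_all add: add.commute)
    fix x :: real assume "\<bar>x\<bar> = 1 \<or> (\<exists>l. 1 \<le> l \<and> l \<le> L \<and> \<bar>x\<bar> = 10 * real l)"
    then obtain k where "\<bar>x\<bar> = real k" "k \<le> h"
    proof
      assume "\<bar>x\<bar> = 1" then show thesis using that[of 1] L by simp
    next
      assume "\<exists>l. 1 \<le> l \<and> l \<le> L \<and> \<bar>x\<bar> = 10 * real l"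
      then obtain l where "l \<le> L" "\<bar>x\<bar> = 10 * real l" by blast
      then show thesis using that[of "10 * l"] L by simp
    qed
    then show "\<bar>poly p x\<bar> \<le> 17 / 12" by (rule pb)
  qed
qed

section \<open>Windows with many changes\<close>

lemma log_ratio_ge: "1 \<le> log_ratio n k" "log 2 (real n / real k) \<le> log_ratio n k"
  unfolding log_ratio_def by auto

lemma finite_dyadic_scales: "finite {e. k < 32 * 2 ^ e \<and> 8 * 2 ^ e \<le> (n::nat)}"
proof (rule finite_subset)
  have "e \<le> n" if "8 * 2 ^ e \<le> n" for e using that less_exp[of e] by linarith
  then show "{e. k < 32 * 2 ^ e \<and> 8 * 2 ^ e \<le> n} \<subseteq> {..n}" by auto
qed simp

text \<open>The extreme scales a and b satisfy k 2^(b-a) \<le> 32 2^b \<le> 4 n, so there are at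
  most 3 + log(n/k) scales; the 3 is absorbed because \<open>log_ratio\<close> is at least
  1.\<close>

lemma card_dyadic_scales_le:
  assumes "k > 0"
  shows "real (card {e. k < 32 * 2 ^ e \<and> 8 * 2 ^ e \<le> n}) \<le> 4 * log_ratio n k"
proof (cases "{e. k < 32 * 2 ^ e \<and> 8 * 2 ^ e \<le> n} = {}")
  case True
  then show ?thesis using log_ratio_ge(1)[of n k] by (simp only: card.empty)
next
  case False
  let ?E = "{e. k < 32 * 2 ^ e \<and> 8 * 2 ^ e \<le> n}"
  have fin: "finite ?E" by (rule finite_dyadic_scales)
  define a b where "a = Min ?E" and "b = Max ?E"
  have ab: "a \<in> ?E" "b \<in> ?E" "a \<le> b"
    using False fin unfolding a_def b_def by (auto simp del: mem_Collect_eq)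
  then have "2 ^ b = 2 ^ a * (2::nat) ^ (b - a)" "k < 32 * 2 ^ a" "8 * 2 ^ b \<le> n"
    by (auto simp flip: power_add)
  then have "real k < 32 * 2 ^ a" "8 * (2 ^ a * 2 ^ (b - a)) \<le> real n"
    by (metis of_nat_less_iff of_nat_mult of_nat_numeral of_nat_power,
        metis of_nat_le_iff of_nat_mult of_nat_numeral of_nat_power)
  moreover from this(1) have "real k * 2 ^ (b - a) \<le> 32 * 2 ^ a * 2 ^ (b - a)"
    by (intro mult_right_mono) auto
  ultimately have "real k * 2 ^ (b - a) \<le> 4 * real n"
    by (simp only: mult.assoc)
  then have "2 powr real (b - a) \<le> 4 * (real n / real k)"
    using assms by (simp add: field_simps powr_realpow)
  moreover have "n > 0" using ab(2) by (auto intro: gr0I)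
  ultimately have "real (b - a) \<le> log 2 (4 * (real n / real k))"
    using assms by (subst le_log_iff) auto
  also have "\<dots> = 2 + log 2 (real n / real k)"
    using assms \<open>n > 0\<close> log_mult[of 2 4 "real n / real k"] by (simp add: log_def ln_realpow[of 2 2, simplified])
  finally have "real (b - a) + 1 \<le> 4 * log_ratio n k"
    using log_ratio_ge[of n k] by linarith
  moreover have "card ?E \<le> card {a..b}"
    using fin unfolding a_def b_def by (intro card_mono) auto
  ultimately show ?thesis using ab(3) by (simp add: of_nat_diff)
qed

text \<open>Indices up to \<open>k / 4\<close> are discarded. The others are classified by their dyadic scale
  \<open>[4 \<cdot> 2\<^sup>e, 8 \<cdot> 2\<^sup>e)\<close>, the quarter of the scale they lie in, and their parity; this gives at most
  \<open>32 log_ratio n k\<close> classes, and each class fits in a window with margin \<open>2\<^sup>e\<close>.\<close>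

lemma dense_window_left:
  assumes k: "k \<ge> 16" and I: "\<And>i. i \<in> I \<Longrightarrow> 2 * i + 2 \<le> n" and card: "k \<le> 2 * card I"
  shows "\<exists>u m. m \<le> u \<and> u + 3 * m \<le> n \<and>
    real k / (256 * log_ratio n k) \<le> real (card {j. j < m \<and> u + 2 * j \<in> I})"
proof -
  have finI: "finite I" using card k by (metis card.infinite le_zero_eq mult_0_right not_numeral_le_zero)
  define I' where "I' = {i \<in> I. k \<le> 4 * i}"
  have finI': "finite I'" using finI unfolding I'_def by simp
  \<comment> \<open>At most (k + 3)/4 of at least k/2 indices are lost, which leaves at least
    k/8.\<close>
  have "I \<subseteq> I' \<union> {..<(k + 3) div 4}" unfolding I'_def by auto
  then have "card I \<le> card (I' \<union> {..<(k + 3) div 4})" using finI' by (intro card_mono) auto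
  also have "\<dots> \<le> card I' + (k + 3) div 4" using card_Un_le[of I' "{..<(k + 3) div 4}"] by simp
  finally have cardI': "k \<le> 8 * card I'" using card k by linarith
  have "\<exists>e. 2 ^ e * 4 \<le> i \<and> i < 2 ^ e * 8" if "i \<in> I'" for i
  proof -
    \<comment> \<open>Here \<open>k \<ge> 16\<close> gives \<open>i \<ge> 4\<close>, so that a
      dyadic scale exists.\<close>
    have "1 \<le> i div 4" using that k unfolding I'_def by auto
    then obtain e where "2 ^ e \<le> i div 4" "i div 4 < 2 ^ (e + 1)"
      using ex_power_ivl1[of 2 "i div 4"] by auto
    then show ?thesis by (intro exI[of _ e]) auto
  qed
  then obtain e where e: "\<And>i. i \<in> I' \<Longrightarrow> 2 ^ e i * 4 \<le> i \<and> i < 2 ^ e i * 8" by metis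
  define f where "f i = (e i, i div 2 ^ e i, i mod 2)" for i
  let ?C = "{e. k < 32 * 2 ^ e \<and> 8 * 2 ^ e \<le> n} \<times> {4..<8::nat} \<times> {0, 1::nat}"
  \<comment> \<open>256 = 8 * 32: at least k/8 indices fall into at most
    \<open>32 * log_ratio n k\<close> classes.\<close>
  let ?X = "real k / (256 * log_ratio n k)"
  have "f i \<in> ?C" if "i \<in> I'" for i
  proof -
    have "k \<le> 4 * i" "2 * i + 2 \<le> n" using that I unfolding I'_def by auto
    moreover have "4 \<le> i div 2 ^ e i" "i div 2 ^ e i < 8"
      using e[OF that] by (auto simp: less_eq_div_iff_mult_less_eq div_less_iff_less_mult mult.commute)
    ultimately show ?thesis using e[OF that] unfolding f_def by auto
  qed
  then have "card (f ` I') \<le> card ?C" by (intro card_mono finite_cartesian_product finite_dyadic_scales) blast+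
  also have "card ?C = 8 * card {e. k < 32 * 2 ^ e \<and> 8 * 2 ^ e \<le> n}"
    by (simp add: card_cartesian_product)
  finally have classes: "real (card (f ` I')) \<le> 32 * log_ratio n k"
    using card_dyadic_scales_le[of k n] k by linarith
  have lr: "1 \<le> log_ratio n k" by (rule log_ratio_ge)
  obtain i0 where i0: "i0 \<in> I'" "?X \<le> real (card {i \<in> I'. f i = f i0})"
  proof (rule ccontr)
    assume "\<not> thesis"
    then have less: "real (card {i \<in> I'. f i = y}) < ?X" if "y \<in> f ` I'" for y
      using that \<open>\<And>i0. _ \<Longrightarrow> _ \<Longrightarrow> thesis\<close> by fastforce
    have ne: "I' \<noteq> {}" using cardI' k by auto
    have "real (card I') = (\<Sum>y\<in>f ` I'. real (card {i \<in> I'. f i = y}))"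
      using sum.image_gen[OF finI', of "\<lambda>_. 1 :: real" f] by simp
    also have "\<dots> < (\<Sum>y\<in>f ` I'. ?X)"
      using less finI' ne by (intro sum_strict_mono) auto
    also have "\<dots> = real (card (f ` I')) * ?X" by simp
    also have "\<dots> \<le> 32 * log_ratio n k * ?X"
      using classes lr by (intro mult_right_mono) auto
    also have "\<dots> = real k / 8" using lr by simp
    finally show False using cardI' by linarith
  qed
  \<comment> \<open>\<open>B\<close> is the length of the quarter containing \<open>i0\<close>,
    \<open>M\<close> its start, and \<open>u\<close> is \<open>M\<close> corrected to the parity of
    the class. The window fits because 4 B \<le> M \<le> i0 gives u + 3 B \<le> 2 i0 + 1.\<close>
  define B where "B = (2::nat) ^ e i0"
  define M where "M = i0 div B * B"
  define u where "u = (if M mod 2 = i0 mod 2 then M else M + 1)"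
  have "4 * B \<le> M"
    using e[OF i0(1)] unfolding M_def B_def by (simp add: less_eq_div_iff_mult_less_eq mult.commute)
  moreover have "M \<le> i0" unfolding M_def by (rule div_times_less_eq_dividend)
  moreover have "2 * i0 + 2 \<le> n" using i0(1) I unfolding I'_def by auto
  moreover have "u \<le> M + 1" "M \<le> u" unfolding u_def by auto
  ultimately have win: "B \<le> u" "u + 3 * B \<le> n" by linarith+
  have "{i \<in> I'. f i = f i0} \<subseteq> (\<lambda>j. u + 2 * j) ` {j. j < B \<and> u + 2 * j \<in> I}"
  proof
    fix i assume i: "i \<in> {i \<in> I'. f i = f i0}"
    then have q: "i div B = i0 div B" and par: "i mod 2 = i0 mod 2"
      unfolding f_def B_def by auto
    have "B > 0" unfolding B_def by simp
    then have "M \<le> i" "i < M + B"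
      unfolding M_def q[symmetric] using div_mult_mod_eq[of i B] mod_less_divisor[of B i] by linarith+
    then have "u \<le> i" using par unfolding u_def by (cases "i = M") auto
    moreover have "even (i - u)"
    proof -
      have "u mod 2 = i mod 2" using par unfolding u_def by (auto simp: mod_Suc)
      then show ?thesis using \<open>u \<le> i\<close> by (metis mod_eq_dvd_iff_nat)
    qed
    ultimately have "i = u + 2 * ((i - u) div 2)" by simp
    moreover have "(i - u) div 2 < B" using \<open>i < M + B\<close> \<open>M \<le> u\<close> \<open>B > 0\<close> by linarith
    moreover have "i \<in> I" using i unfolding I'_def by simp
    ultimately show "i \<in> (\<lambda>j. u + 2 * j) ` {j. j < B \<and> u + 2 * j \<in> I}" by force
  qed
  then have "card {i \<in> I'. f i = f i0} \<le> card {j. j < B \<and> u + 2 * j \<in> I}"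
    by (rule surj_card_le[rotated]) simp
  then show ?thesis using win i0(2) by (intro exI[of _ u] exI[of _ B]) auto
qed

text \<open>The two conditions on \<open>u\<close> and \<open>m\<close> say that \<open>m\<close>
  quads fit with shift \<open>a = u - m\<close>, whose levels start at \<open>u\<close>. At least
  half of \<open>I\<close> lies in one half of the range, and reflection moves the right half to the
  left.\<close>

lemma dense_window:
  assumes k: "card I \<ge> 16" and I: "\<And>i. i \<in> I \<Longrightarrow> i + 2 \<le> n"
  shows "\<exists>u m. m \<le> u \<and> u + 3 * m \<le> n \<and>
    real (card I) / (256 * log_ratio n (card I)) \<le> real (card {j. j < m \<and> u + 2 * j \<in> I})"
proof -
  let ?L = "{i \<in> I. 2 * i + 2 \<le> n}" and ?R = "{i \<in> I. n < 2 * i + 2}"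
  have finI: "finite I" using k card.infinite by fastforce
  have "card I = card (?L \<union> ?R)" by (rule arg_cong[of _ _ card]) auto
  also have "\<dots> \<le> card ?L + card ?R" by (rule card_Un_le)
  finally consider "card I \<le> 2 * card ?L" | "card I \<le> 2 * card ?R" by linarith
  then show ?thesis
  proof cases
    case 1
    then obtain u m where um: "m \<le> u" "u + 3 * m \<le> n"
      "real (card I) / (256 * log_ratio n (card I)) \<le> real (card {j. j < m \<and> u + 2 * j \<in> ?L})"
      using dense_window_left[OF k, of ?L n] by blast
    moreover have "card {j. j < m \<and> u + 2 * j \<in> ?L} \<le> card {j. j < m \<and> u + 2 * j \<in> I}"
      by (intro card_mono) auto
    ultimately show ?thesis by (intro exI[of _ u] exI[of _ m]) linarith
  next
    case 2
    \<comment> \<open>Reflection of {0..n} carries the pair i, i + 2 to a pair starting at n - 2 -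
      i; a window from \<open>u\<close> becomes one from \<open>n - u - 2 * m\<close>, run through
      backwards.\<close>
    let ?r = "\<lambda>i. n - 2 - i"
    have "inj_on ?r ?R"
    proof (rule inj_onI)
      fix i j assume "i \<in> ?R" "j \<in> ?R" and eq: "?r i = ?r j"
      then have "i + 2 \<le> n" "j + 2 \<le> n" using I by auto
      with eq show "i = j" by linarith
    qed
    then have c: "card (?r ` ?R) = card ?R" by (rule card_image)
    have "\<And>i. i \<in> ?r ` ?R \<Longrightarrow> 2 * i + 2 \<le> n" using I by force
    then obtain u m where um: "m \<le> u" "u + 3 * m \<le> n"
      "real (card I) / (256 * log_ratio n (card I)) \<le> real (card {j. j < m \<and> u + 2 * j \<in> ?r ` ?R})"
      using dense_window_left[OF k, of "?r ` ?R" n] 2 c by auto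
    have "card {j. j < m \<and> u + 2 * j \<in> ?r ` ?R} \<le> card {j. j < m \<and> (n - u - 2 * m) + 2 * j \<in> I}"
    proof (rule card_inj_on_le[where f = "\<lambda>j. m - 1 - j"])
      show "inj_on (\<lambda>j. m - 1 - j) {j. j < m \<and> u + 2 * j \<in> ?r ` ?R}"
        by (auto intro!: inj_onI)
      show "(\<lambda>j. m - 1 - j) ` {j. j < m \<and> u + 2 * j \<in> ?r ` ?R} \<subseteq> {j. j < m \<and> (n - u - 2 * m) + 2 * j \<in> I}"
      proof clarify
        fix j i assume j: "j < m" "u + 2 * j = ?r i" "i \<in> I"
        then have "(n - u - 2 * m) + 2 * (m - 1 - j) = i" using I[of i] um(2) by linarith
        then show "m - 1 - j < m \<and> (n - u - 2 * m) + 2 * (m - 1 - j) \<in> I" using j by auto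
      qed
    qed simp
    moreover have "m \<le> n - u - 2 * m" "(n - u - 2 * m) + 3 * m \<le> n" using um by linarith+
    ultimately show ?thesis using um(3) by (intro exI[of _ "n - u - 2 * m"] exI[of _ m]) linarith
  qed
qed

text \<open>By minimality, lowering \<open>r_zero\<close> or \<open>r_one\<close> by 1 destroys
  periodicity even with the largest admissible partner \<open>n div 2\<close>. The violating index
  lies about \<open>r_max\<close> away from both ends.\<close>

lemma central_jump:
  assumes "r_max n F \<ge> 1"
  shows "\<exists>i. r_max n F \<le> i + 2 \<and> i + r_max n F \<le> n \<and> i + 2 \<le> n \<and>
    predicate_of n F i \<noteq> predicate_of n F (i + 2)"
proof -
  let ?h = "n div 2"
  have h: "real ?h \<le> real n / 2" by linarith
  consider "r_max n F = r_zero n F" | "r_max n F = r_one n F" unfolding r_max_def by linarith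
  then show ?thesis
  proof cases
    case 1
    then have lt: "r_zero n F - 1 < r_zero n F" using assms by linarith
    have "\<not> (\<exists>b. real b \<le> real n / 2 \<and> two_periodic_on n F (r_zero n F - 1) b)"
      using lt unfolding r_zero_def by (rule not_less_Least)
    then have "\<not> two_periodic_on n F (r_zero n F - 1) ?h" using h by blast
    then obtain i where "r_zero n F - 1 \<le> i" "i + ?h < n" "i + 2 \<le> n"
      "predicate_of n F i \<noteq> predicate_of n F (i + 2)"
      unfolding two_periodic_on_def by blast
    then show ?thesis unfolding 1 by (intro exI[of _ i]) auto
  next
    case 2
    then have lt: "r_one n F - 1 < r_one n F" using assms by linarith
    have "\<not> (\<exists>a. real a \<le> real n / 2 \<and> two_periodic_on n F a (r_one n F - 1))"
      using lt unfolding r_one_def by (rule not_less_Least)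
    then have "\<not> two_periodic_on n F ?h (r_one n F - 1)" using h by blast
    then obtain i where "?h \<le> i" "i + (r_one n F - 1) < n" "i + 2 \<le> n"
      "predicate_of n F i \<noteq> predicate_of n F (i + 2)"
      unfolding two_periodic_on_def by blast
    then show ?thesis using assms unfolding 2 by (intro exI[of _ i]) auto
  qed
qed

section \<open>Lower bounds\<close>

lemma finite_sign_cube [simp]: "finite (sign_cube n)"
  unfolding sign_cube_def by (rule finite_PiE) auto

lemma sign_cube_nonempty: "sign_cube n \<noteq> {}"
  using quad_point_in_cube by blast

text \<open>Fourier inversion: the product of all \<open>a i * x i + 1\<close> is
  \<open>2 ^ n\<close> if \<open>a = x\<close> and 0 otherwise.\<close>

lemma mpoly_interpolates: "\<exists>c. \<forall>x\<in>sign_cube n. mpoly_eval n c x = F x"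
proof (intro exI ballI)
  let ?c = "\<lambda>S. (\<Sum>a\<in>sign_cube n. F a * (\<Prod>i\<in>S. a i)) / 2 ^ n"
  fix x assume x: "x \<in> sign_cube n"
  have sign: "a i \<in> {-1, 1}" if "a \<in> sign_cube n" "i < n" for a i
    using that unfolding sign_cube_def by blast
  have kernel: "(\<Prod>i<n. a i * x i + 1) = (if a = x then 2 ^ n else 0)" if a: "a \<in> sign_cube n" for a
  proof (cases "a = x")
    case True
    have "(\<Prod>i<n. a i * x i + 1) = (\<Prod>i<n. 2)"
      using sign[OF a] unfolding True by (intro prod.cong) fastforce+
    then show ?thesis using True by simp
  next
    case False
    then obtain i where i: "i < n" "a i \<noteq> x i"
      using PiE_ext[OF a[unfolded sign_cube_def] x[unfolded sign_cube_def]] by auto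
    then have "a i * x i + 1 = 0"
      using sign[OF a i(1)] sign[OF x i(1)] by auto
    then have "(\<Prod>i<n. a i * x i + 1) = 0" using i(1) by (intro prod_zero) auto
    then show ?thesis using False by simp
  qed
  have "mpoly_eval n ?c x = (\<Sum>S\<in>Pow {..<n}. \<Sum>a\<in>sign_cube n. F a * (\<Prod>i\<in>S. a i * x i) / 2 ^ n)"
    unfolding mpoly_eval_def
    by (simp add: sum_divide_distrib sum_distrib_right prod.distrib mult.assoc)
  also have "\<dots> = (\<Sum>a\<in>sign_cube n. F a * (\<Sum>S\<in>Pow {..<n}. \<Prod>i\<in>S. a i * x i) / 2 ^ n)"
    by (subst sum.swap) (simp add: sum_divide_distrib sum_distrib_left)
  also have "\<dots> = (\<Sum>a\<in>sign_cube n. F a * (\<Prod>i<n. a i * x i + 1) / 2 ^ n)"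
    by (simp add: prod_add)
  also have "\<dots> = (\<Sum>a\<in>sign_cube n. if a = x then F a else 0)"
    by (intro sum.cong) (simp_all add: kernel)
  also have "\<dots> = F x" using x by simp
  finally show "mpoly_eval n ?c x = F x" .
qed

lemma symmetric_fun_sign: "symmetric_fun n F \<Longrightarrow> x \<in> sign_cube n \<Longrightarrow> F x \<in> {-1, 1}"
  unfolding symmetric_fun_def by blast

text \<open>\<open>predicate_of\<close> is defined by choice, so its value is controlled only at
  weights that some cube point attains; a quad point is such a witness.\<close>

lemma predicate_of_sign:
  assumes F: "symmetric_fun n F" and m: "4 * m + a \<le> n" "j \<le> m"
  shows "predicate_of n F (m + a + 2 * j) \<in> {-1, 1}"
proof -
  have "{..<j} \<in> level m j" using m(2) unfolding level_def by auto
  then have "hamming_weight n (quad_point n m a {} {} {..<j}) = m + a + 2 * j"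
    by (rule hamming_weight_quad_point[OF m(1)])
  then show ?thesis
    using predicate_of_hamming_weight[OF F quad_point_in_cube] symmetric_fun_sign[OF F quad_point_in_cube]
    by metis
qed

text \<open>\<open>F\<close> is constant on each level, so the mean of \<open>f\<close> there has
  the sign of \<open>F\<close> and size at least \<open>\<mu>\<close>. An error below
  \<open>\<mu>\<close> cannot change this sign.\<close>

lemma sign_changes_le_degree_of_approximant:
  assumes F: "symmetric_fun n F" and m: "4 * m + a \<le> n"
    and margin: "\<And>x. x \<in> sign_cube n \<Longrightarrow> \<mu> \<le> f x * F x"
    and g: "\<And>j. j \<le> m \<Longrightarrow> \<bar>block_mean n m a z f j - poly g (real j)\<bar> < \<mu>"
  shows "card {j. j < m \<and> predicate_of n F (m + a + 2 * j) \<noteq> predicate_of n F (m + a + 2 * Suc j)}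
    \<le> degree g"
proof (rule sign_changes_le_degree)
  fix j assume j: "j \<le> m"
  let ?D = "predicate_of n F (m + a + 2 * j)"
  show D: "?D \<in> {-1, 1}" by (rule predicate_of_sign[OF F m j])
  have Fx: "F x = ?D" if "x \<in> sign_cube n" "hamming_weight n x = m + a + 2 * j" for x
    using predicate_of_hamming_weight[OF F that(1)] that(2) by simp
  show "0 < poly g (real j) * ?D"
  proof (cases "?D = 1")
    case True
    have "\<mu> \<le> block_mean n m a z f j"
      by (rule block_mean_ge[OF m j]) (use margin Fx True in fastforce)
    then show ?thesis using g[OF j] True by simp
  next
    case False
    then have D1: "?D = -1" using D by simp
    have "block_mean n m a z f j \<le> - \<mu>"
      by (rule block_mean_le[OF m j]) (use margin Fx D1 in fastforce)
    then show ?thesis using g[OF j] D1 by simp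
  qed
qed

section \<open>Monomial complexity and margin\<close>

lemma alternating_window:
  assumes k: "deg_oe n F \<ge> 16"
  shows "\<exists>m a d. 4 * m + a \<le> n \<and> d \<ge> 1 \<and> real (deg_oe n F) / (256 * log_ratio n (deg_oe n F)) \<le> real d \<and>
    d = card {j. j < m \<and> predicate_of n F (m + a + 2 * j) \<noteq> predicate_of n F (m + a + 2 * Suc j)}"
proof -
  let ?I = "{i. i + 2 \<le> n \<and> predicate_of n F i \<noteq> predicate_of n F (i + 2)}"
  obtain u m where um: "m \<le> u" "u + 3 * m \<le> n"
    and c: "real (card ?I) / (256 * log_ratio n (card ?I)) \<le> real (card {j. j < m \<and> u + 2 * j \<in> ?I})"
    using dense_window[of ?I n] k unfolding deg_oe_def by auto
  let ?J = "{j. j < m \<and> u + 2 * j \<in> ?I}"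
  have J: "?J = {j. j < m \<and> predicate_of n F (m + (u - m) + 2 * j) \<noteq> predicate_of n F (m + (u - m) + 2 * Suc j)}"
    using um by auto
  have "0 < real (deg_oe n F) / (256 * log_ratio n (deg_oe n F))"
    using k log_ratio_ge(1)[of n "deg_oe n F"] by (intro divide_pos_pos) auto
  then have "0 < real (card ?J)" using c unfolding deg_oe_def by linarith
  then have "card ?J \<ge> 1" by simp
  moreover have "4 * m + (u - m) \<le> n" using um by linarith
  moreover have "real (deg_oe n F) / (256 * log_ratio n (deg_oe n F)) \<le> real (card ?J)"
    using c unfolding deg_oe_def .
  moreover have "card ?J = card {j. j < m \<and> predicate_of n F (m + (u - m) + 2 * j)
      \<noteq> predicate_of n F (m + (u - m) + 2 * Suc j)}" by (simp only: J)
  ultimately show ?thesis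
    by - (rule exI[of _ m], rule exI[of _ "u - m"], rule exI[of _ "card ?J"], intro conjI)
qed

lemma min_margin_le:
  assumes "x \<in> sign_cube n"
  shows "Min ((\<lambda>x. f x * F x) ` sign_cube n) \<le> f x * F x"
  using assms by (intro Min_le) auto

lemma min_margin_pos:
  assumes F: "symmetric_fun n F" and c: "sign_represents n c F"
  shows "0 < Min ((\<lambda>x. mpoly_eval n c x * F x) ` sign_cube n)"
proof -
  have "0 < mpoly_eval n c x * F x" if "x \<in> sign_cube n" for x
    using c symmetric_fun_sign[OF F that] that unfolding sign_represents_def
    by (auto simp: sgn_if zero_less_mult_iff split: if_splits)
  then show ?thesis using sign_cube_nonempty by (subst Min_gr_iff) auto
qed

lemma num_monomials_ge:
  assumes F: "symmetric_fun n F" and c: "sign_represents n c F" and m: "4 * m + a \<le> n" and d1: "d \<ge> 1"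
    and d: "d = card {j. j < m \<and> predicate_of n F (m + a + 2 * j) \<noteq> predicate_of n F (m + a + 2 * Suc j)}"
  shows "2 ^ d \<le> num_monomials n c"
proof (rule ccontr)
  assume "\<not> ?thesis"
  then obtain g :: "real poly" and z where g: "degree g < d"
    "\<And>j. j \<le> m \<Longrightarrow> block_mean n m a z (mpoly_eval n c) j = poly g (real j)"
    using block_mean_eq_polynomial[OF _ d1, of m n c a] m by auto
  have "d \<le> degree g"
    unfolding d
  proof (rule sign_changes_le_degree_of_approximant[OF F m])
    show "\<bar>block_mean n m a z (mpoly_eval n c) j - poly g (real j)\<bar>
      < Min ((\<lambda>x. mpoly_eval n c x * F x) ` sign_cube n)" if "j \<le> m" for j
      using min_margin_pos[OF F c] g(2)[OF that] by simp
  qed (rule min_margin_le)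
  then show False using g(1) by simp
qed

lemma min_margin_le_power:
  assumes F: "symmetric_fun n F" and W: "mpoly_weight n c \<le> 1" and m: "4 * m + a \<le> n" and d1: "d \<ge> 1"
    and d: "d = card {j. j < m \<and> predicate_of n F (m + a + 2 * j) \<noteq> predicate_of n F (m + a + 2 * Suc j)}"
  shows "Min ((\<lambda>x. mpoly_eval n c x * F x) ` sign_cube n) \<le> 1 / 2 ^ d"
proof (rule ccontr)
  assume less: "\<not> ?thesis"
  obtain g :: "real poly" and z where g: "degree g < d"
    "\<And>j. j \<le> m \<Longrightarrow> \<bar>block_mean n m a z (mpoly_eval n c) j - poly g (real j)\<bar> \<le> mpoly_weight n c / 2 ^ d"
    using block_mean_approx_weight[OF _ d1, of m n a c] m by auto
  have "mpoly_weight n c / 2 ^ d \<le> 1 / 2 ^ d" using W by (intro divide_right_mono) auto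
  then have gap: "\<bar>block_mean n m a z (mpoly_eval n c) j - poly g (real j)\<bar>
      < Min ((\<lambda>x. mpoly_eval n c x * F x) ` sign_cube n)" if "j \<le> m" for j
    using g(2)[OF that] less by linarith
  have "d \<le> degree g"
    unfolding d by (rule sign_changes_le_degree_of_approximant[OF F m min_margin_le gap])
  then show False using g(1) by simp
qed

lemma sign_represents_interpolant:
  assumes "symmetric_fun n F" "\<forall>x\<in>sign_cube n. mpoly_eval n c x = F x"
  shows "sign_represents n c F"
  unfolding sign_represents_def
proof
  fix x assume x: "x \<in> sign_cube n"
  show "sgn (mpoly_eval n c x) = F x"
    using assms(2) symmetric_fun_sign[OF assms(1) x] x by auto
qed

lemma signed_monomial_complexity_ge:
  assumes F: "symmetric_fun n F" and k: "deg_oe n F \<ge> 16"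
  shows "2 powr (real (deg_oe n F) / (256 * log_ratio n (deg_oe n F)))
    \<le> real (signed_monomial_complexity n F)"
proof -
  obtain m a d where m: "4 * m + a \<le> n" "d \<ge> 1"
    and kd: "real (deg_oe n F) / (256 * log_ratio n (deg_oe n F)) \<le> real d"
    and d: "d = card {j. j < m \<and> predicate_of n F (m + a + 2 * j) \<noteq> predicate_of n F (m + a + 2 * Suc j)}"
    using alternating_window[OF k] by blast
  \<comment> \<open>The interpolant shows that the set under \<open>LEAST\<close> is nonempty, so
    the minimum is attained.\<close>
  obtain c0 where "\<forall>x\<in>sign_cube n. mpoly_eval n c0 x = F x" using mpoly_interpolates by blast
  then have "\<exists>c. sign_represents n c F \<and> num_monomials n c = num_monomials n c0"
    using sign_represents_interpolant[OF F] by blast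
  then have "\<exists>c. sign_represents n c F \<and> num_monomials n c = signed_monomial_complexity n F"
    unfolding signed_monomial_complexity_def by (rule LeastI)
  then have "2 ^ d \<le> signed_monomial_complexity n F"
    using num_monomials_ge[OF F _ m d] by metis
  then have "2 powr real d \<le> real (signed_monomial_complexity n F)"
    by (metis of_nat_le_iff of_nat_numeral of_nat_power powr_realpow zero_less_numeral)
  moreover have "2 powr (real (deg_oe n F) / (256 * log_ratio n (deg_oe n F))) \<le> 2 powr real d"
    using kd by simp
  ultimately show ?thesis by linarith
qed

lemma margin_le:
  assumes F: "symmetric_fun n F" and k: "deg_oe n F \<ge> 16"
  shows "margin n F \<le> 2 powr (- (real (deg_oe n F) / (256 * log_ratio n (deg_oe n F))))"
proof -
  obtain m a d where m: "4 * m + a \<le> n" "d \<ge> 1"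
    and kd: "real (deg_oe n F) / (256 * log_ratio n (deg_oe n F)) \<le> real d"
    and d: "d = card {j. j < m \<and> predicate_of n F (m + a + 2 * j) \<noteq> predicate_of n F (m + a + 2 * Suc j)}"
    using alternating_window[OF k] by blast
  let ?V = "{Min ((\<lambda>x. mpoly_eval n c x * F x) ` sign_cube n) |c. mpoly_weight n c \<le> 1 \<and> sign_represents n c F}"
  obtain c0 where c0: "\<forall>x\<in>sign_cube n. mpoly_eval n c0 x = F x" using mpoly_interpolates by blast
  \<comment> \<open>Scaling the interpolant by this factor gives weight at most 1, so the supremum
    is over a nonempty set.\<close>
  let ?s = "1 / (1 + mpoly_weight n c0)"
  have W0: "mpoly_weight n c0 \<ge> 0" unfolding mpoly_weight_def by (rule sum_nonneg) simp
  have "mpoly_eval n (\<lambda>S. ?s * c0 S) x = ?s * mpoly_eval n c0 x" for x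
    unfolding mpoly_eval_def by (simp add: sum_distrib_left mult.assoc)
  then have "sign_represents n (\<lambda>S. ?s * c0 S) F"
    using sign_represents_interpolant[OF F c0] W0 unfolding sign_represents_def by (simp add: sgn_mult)
  moreover have "mpoly_weight n (\<lambda>S. ?s * c0 S) = ?s * mpoly_weight n c0"
    using W0 unfolding mpoly_weight_def by (simp add: abs_mult sum_distrib_left)
  then have "mpoly_weight n (\<lambda>S. ?s * c0 S) \<le> 1" using W0 by simp
  ultimately have "?V \<noteq> {}" by blast
  then have "margin n F \<le> 1 / 2 ^ d"
    unfolding margin_def using min_margin_le_power[OF F _ m d] by (intro cSup_least) auto
  also have "\<dots> = 2 powr (- real d)" by (simp add: powr_minus powr_realpow divide_inverse)
  also have "\<dots> \<le> 2 powr (- (real (deg_oe n F) / (256 * log_ratio n (deg_oe n F))))"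
    using kd by simp
  finally show ?thesis .
qed

section \<open>Approximate weight\<close>

lemma approximant_weight_ge:
  assumes F: "symmetric_fun n F" and r: "r_max n F \<ge> 5"
    and c: "\<And>x. x \<in> sign_cube n \<Longrightarrow> \<bar>mpoly_eval n c x - F x\<bar> < 1 / 3"
  shows "2 powr (real (r_max n F) / 250) \<le> mpoly_weight n c"
proof -
  let ?r = "r_max n F" and ?W = "mpoly_weight n c"
  obtain i where i: "?r \<le> i + 2" "i + ?r \<le> n" "predicate_of n F i \<noteq> predicate_of n F (i + 2)"
    using central_jump[of n F] r by auto
  \<comment> \<open>The jump at \<open>i\<close> is to sit at level \<open>h\<close> of
    \<open>2 * h + 2\<close> levels. Then 4 m + a = i + 4 h + 3, which is at most n by the choice of
    \<open>h\<close>, and \<open>a\<close> is not truncated since 4 h + 1 \<le> r - 2 \<le>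
    i.\<close>
  define h where "h = (?r - 3) div 4"
  define m where "m = 2 * h + 1"
  define a where "a = i - 4 * h - 1"
  define L where "L = h div 10"
  have h: "4 * h + 3 \<le> ?r" "?r \<le> 4 * h + 6" unfolding h_def using r by linarith+
  have "4 * h + 1 \<le> i" using h i(1) by linarith
  then have a: "i = a + (4 * h + 1)" unfolding a_def by simp
  have m: "4 * m + a \<le> n" unfolding m_def using h(1) i(2) a by (simp add: algebra_simps)
  then have m': "4 * m \<le> n" by linarith
  define D where "D j = predicate_of n F (m + a + 2 * j)" for j
  have "m + a + 2 * h = i" "m + a + 2 * Suc h = i + 2" unfolding m_def a by simp_all
  then have jump: "D h \<noteq> D (Suc h)" unfolding D_def using i(3) by simp
  have Dsign: "D j \<in> {-1, 1}" if "j \<le> m" for j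
    unfolding D_def by (rule predicate_of_sign[OF F m that])
  have mean: "\<bar>block_mean n m a z (mpoly_eval n c) j - D j\<bar> \<le> 1 / 3" if "j \<le> m" for z j
  proof -
    have "D j - 1 / 3 \<le> mpoly_eval n c x \<and> mpoly_eval n c x \<le> D j + 1 / 3"
      if "x \<in> sign_cube n" "hamming_weight n x = m + a + 2 * j" for x
    proof -
      have "F x = D j" using predicate_of_hamming_weight[OF F that(1)] that(2) unfolding D_def by simp
      then show ?thesis using c[OF that(1)] unfolding abs_less_iff by linarith
    qed
    then have "D j - 1 / 3 \<le> block_mean n m a z (mpoly_eval n c) j"
      "block_mean n m a z (mpoly_eval n c) j \<le> D j + 1 / 3"
      by (intro block_mean_ge[OF m that] block_mean_le[OF m that]; blast)+
    then have "block_mean n m a z (mpoly_eval n c) j - D j \<le> 1 / 3"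
      "- (block_mean n m a z (mpoly_eval n c) j - D j) \<le> 1 / 3" by linarith+
    then show ?thesis by (rule abs_leI)
  qed
  \<comment> \<open>For d = 1 a single constant is within W/2 + 1/3 of both 1 and -1.\<close>
  have W_const: "4 / 3 \<le> ?W"
  proof -
    obtain g :: "real poly" and z where g: "degree g < 1"
      "\<And>j. j \<le> m \<Longrightarrow> \<bar>block_mean n m a z (mpoly_eval n c) j - poly g (real j)\<bar> \<le> ?W / 2"
      using block_mean_approx_weight[OF m', of 1 a c] by auto
    from g(1) obtain q where "g = [:q:]" by (metis degree_eq_zeroE less_one)
    then have q: "poly g (real j) = q" for j by simp
    have hm: "h \<le> m" "Suc h \<le> m" unfolding m_def by auto
    have "\<bar>D h - D (Suc h)\<bar> = 2"
      using Dsign[OF hm(1)] Dsign[OF hm(2)] jump by auto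
    then show ?thesis
      using g(2)[OF hm(1)] g(2)[OF hm(2)] mean[OF hm(1), of z] mean[OF hm(2), of z]
      unfolding q by linarith
  qed
  have W_exp: "2 ^ (2 * L) \<le> 4 * ?W" if "L \<ge> 1"
  proof (rule ccontr)
    assume less: "\<not> ?thesis"
    obtain g :: "real poly" and z where g: "degree g < 2 * L + 2"
      "\<And>j. j \<le> m \<Longrightarrow> \<bar>block_mean n m a z (mpoly_eval n c) j - poly g (real j)\<bar> \<le> ?W / 2 ^ (2 * L + 2)"
      using block_mean_approx_weight[OF m', of "2 * L + 2" a c] by auto
    \<comment> \<open>The restriction error 1/12 and the approximation error 1/3 add up to the 5/12
      of \<open>no_low_degree_jump\<close>.\<close>
    have "?W / 2 ^ (2 * L + 2) \<le> 1 / 12" using less W_const by (simp add: field_simps)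
    then have "\<bar>poly g (real j) - D j\<bar> \<le> 5 / 12" if "j \<le> m" for j
      using g(2)[OF that] mean[OF that, of z] by linarith
    then have "D h = D (Suc h)"
      using no_low_degree_jump[OF that _ g(1), of h D] Dsign unfolding L_def m_def by auto
    then show False using jump by simp
  qed
  \<comment> \<open>The constant 250 comes from \<open>L \<le> 1\<close>: then h \<le> 19 and r
    \<le> 82, so r/250 \<le> 1/3, and 2 \<le> (4/3)^3. For larger \<open>L\<close> the exponential
    bound has room to spare.\<close>
  show ?thesis
  proof (cases "L \<le> 1")
    case True
    then have "real ?r / 250 \<le> 1 / 3" using h unfolding L_def by linarith
    then have "2 powr (real ?r / 250) \<le> 2 powr (1 / 3)" by simp
    also have "\<dots> \<le> ((4 / 3) ^ 3) powr (1 / 3)" by (rule powr_mono2) (auto simp: power3_eq_cube)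
    also have "\<dots> = 4 / 3" by (simp add: powr_powr flip: powr_numeral)
    finally show ?thesis using W_const by linarith
  next
    case False
    then have "real ?r / 250 \<le> 2 * real L - 2" using h unfolding L_def by linarith
    then have "2 powr (real ?r / 250) \<le> 2 powr (2 * real L - 2)" by simp
    also have "\<dots> = 2 ^ (2 * L) / 4" by (simp add: powr_diff powr_realpow[of 2 "2 * L", simplified])
    finally show ?thesis using W_exp False by simp
  qed
qed

lemma log_approx_weight_ge:
  assumes F: "symmetric_fun n F" and r: "r_max n F \<ge> 5"
  shows "real (r_max n F) / 250 \<le> log 2 (approx_weight n (1 / 3) F)"
proof -
  let ?A = "{mpoly_weight n c |c. \<forall>x\<in>sign_cube n. \<bar>mpoly_eval n c x - F x\<bar> < 1 / 3}"
  obtain c0 where "\<forall>x\<in>sign_cube n. mpoly_eval n c0 x = F x" using mpoly_interpolates by blast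
  \<comment> \<open>A bound on all members passes to the infimum only because the set is
    nonempty.\<close>
  then have "mpoly_weight n c0 \<in> ?A" by auto
  then have "2 powr (real (r_max n F) / 250) \<le> approx_weight n (1 / 3) F"
    unfolding approx_weight_def using approximant_weight_ge[OF F r] by (intro cInf_greatest) auto
  moreover from this have "0 < approx_weight n (1 / 3) F"
    by (rule less_le_trans[rotated]) simp
  ultimately show ?thesis by (subst le_log_iff) simp_all
qed

theorem mainTheorem1:
  "(\<exists>c\<^sub>1::real. c\<^sub>1 > 0 \<and>
      (\<forall>(n::nat) F. symmetric_fun n F \<longrightarrow> r_max n F \<ge> 5 \<longrightarrow>
         log 2 (approx_weight n (1/3) F) \<ge> c\<^sub>1 * real (r_max n F))) \<and>
   (\<exists>c\<^sub>2::real. c\<^sub>2 > 0 \<and>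
      (\<forall>(n::nat) F k. symmetric_fun n F \<longrightarrow> k = deg_oe n F \<longrightarrow> k \<ge> 16 \<longrightarrow>
         real (signed_monomial_complexity n F) \<ge> 2 powr (c\<^sub>2 * real k / log_ratio n k))) \<and>
   (\<exists>c\<^sub>3::real. c\<^sub>3 > 0 \<and>
      (\<forall>(n::nat) F k. symmetric_fun n F \<longrightarrow> k = deg_oe n F \<longrightarrow> k \<ge> 16 \<longrightarrow>
         margin n F \<le> 2 powr (- (c\<^sub>3 * real k / log_ratio n k))))"
proof (intro conjI)
  show "\<exists>c\<^sub>1::real. c\<^sub>1 > 0 \<and>
      (\<forall>(n::nat) F. symmetric_fun n F \<longrightarrow> r_max n F \<ge> 5 \<longrightarrow>
         log 2 (approx_weight n (1/3) F) \<ge> c\<^sub>1 * real (r_max n F))"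
    using log_approx_weight_ge by (intro exI[of _ "1 / 250"]) auto
  show "\<exists>c\<^sub>2::real. c\<^sub>2 > 0 \<and>
      (\<forall>(n::nat) F k. symmetric_fun n F \<longrightarrow> k = deg_oe n F \<longrightarrow> k \<ge> 16 \<longrightarrow>
         real (signed_monomial_complexity n F) \<ge> 2 powr (c\<^sub>2 * real k / log_ratio n k))"
    using signed_monomial_complexity_ge by (intro exI[of _ "1 / 256"]) auto
  show "\<exists>c\<^sub>3::real. c\<^sub>3 > 0 \<and>
      (\<forall>(n::nat) F k. symmetric_fun n F \<longrightarrow> k = deg_oe n F \<longrightarrow> k \<ge> 16 \<longrightarrow>
         margin n F \<le> 2 powr (- (c\<^sub>3 * real k / log_ratio n k)))"
    using margin_le by (intro exI[of _ "1 / 256"]) auto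
qed

end
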